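(* Let $\mathbf Y$ be a collection of metric graphs with projections $\{\pi_Y\}$ and constant $\theta$ as in the context, let $K\ge4\theta$, and let $\mathcal C_K(\mathbf Y)$ be the associated quasi-tree of metric spaces. Then there exists $C$ such that $\mathcal C_K(\mathbf Y)$ is $(C,C)$-quasi-isometric to a tree-graded space each of whose pieces is $(C,C)$-quasi-isometric to some $Y\in\mathbf Y$.
   Context: Setting. $\mathbf Y=\{(Y,\rho_Y)\}$ is a collection of connected graphs, each with its path metric with edges of length one. For all $X\ne Y$ in $\mathbf Y$ there is a nonempty set of vertices $\pi_Y(X)\subseteq Y$, and $d_Y(X,Z)=\operatorname{diam}(\pi_Y(X)\cup\pi_Y(Z))$ for $X,Z\in\mathbf Y\setminus\{Y\}$. There is an integer $\theta\ge0$ such that: - $d_Y(X,X)\le\theta$ for $X\neq Y$; - (P1') for pairwise distinct $X,Y,Z$: if $d_Y(X,Z)>\theta$ then $\pi_X(Y)=\pi_X(Z)$; - for all $X,Z\in\mathbf Y$ the set $\{Y\in\mathbf Y\setminus\{X,Z\}:d_Y(X,Z)>\theta\}$ is finite. (Consequently $d_Y$ is symmetric, satisfies the triangle inequality, and if $d_Y(X,Z)>\theta$ then $d_Z(X,W)=d_Z(Y,W)$ for all $W\ne Z$.) $K>0$ is an integer. $\mathcal P_K(\mathbf Y)$ is the graph with vertex set $\mathbf Y$ with distinct $X,Z$ adjacent iff $d_Y(X,Z)\le K$ for all $Y\in\mathbf Y\setminus\{X,Z\}$. The quasi-tree of metric spaces $\mathcal C_K(\mathbf Y)$ is obtained from the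 disjoint union of the graphs in $\mathbf Y$ by adding, for each pair $X,Y$ adjacent in $\mathcal P_K(\mathbf Y)$, an edge of length $K$ connecting every point of $\pi_Y(X)$ to every point of $\pi_X(Y)$; it carries the induced path metric. A geodesic metric space $T$ is tree-graded with respect to a collection $\mathcal Q$ of geodesic subspaces, called pieces, if distinct elements of $\mathcal Q$ intersect in at most one point and every simple loop in $T$ is contained in some element of $\mathcal Q$. $(C,C)$-quasi-isometric means there is a quasi-isometry with multiplicative and additive constants $C$ (and $C$-coarsely surjective). *)

theory Defs
  imports "HOL-Analysis.Analysis"
begin

section \<open>Metric graphs\<close>

text \<open>A simple graph is a vertex set \<open>V\<close> with an adjacency relation \<open>A\<close>.\<close>

definition simple_graph :: "'a set \<Rightarrow> ('a \<Rightarrow> 'a \<Rightarrow> bool) \<Rightarrow> bool" where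
  "simple_graph V A \<longleftrightarrow> (\<forall>u v. A u v \<longrightarrow> u \<in> V \<and> v \<in> V \<and> u \<noteq> v \<and> A v u)"

definition connected_graph :: "'a set \<Rightarrow> ('a \<Rightarrow> 'a \<Rightarrow> bool) \<Rightarrow> bool" where
  "connected_graph V A \<longleftrightarrow> simple_graph V A \<and> (\<forall>u\<in>V. \<forall>v\<in>V. A\<^sup>*\<^sup>* u v)"

text \<open>Points of the geometric realization are given by barycentric coordinates: a point is a
  function on the vertices, and \<open>edge_pt u v t\<close> divides the edge \<open>uv\<close> in the proportion
  \<open>t : 1 - t\<close>.  The point does not depend on the orientation of the edge:
  \<open>edge_pt u v t = edge_pt v u (1 - t)\<close> for \<open>u \<noteq> v\<close>; moreover
  \<open>edge_pt u v 0 = vertex_pt u\<close> and \<open>edge_pt u v 1 = vertex_pt v\<close>.\<close>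

definition vertex_pt :: "'a \<Rightarrow> 'a \<Rightarrow> real" where
  "vertex_pt u = (\<lambda>w. if w = u then 1 else 0)"

definition edge_pt :: "'a \<Rightarrow> 'a \<Rightarrow> real \<Rightarrow> 'a \<Rightarrow> real" where
  "edge_pt u v t = (\<lambda>w. if w = u then 1 - t else if w = v then t else 0)"

definition realization :: "'a set \<Rightarrow> ('a \<Rightarrow> 'a \<Rightarrow> bool) \<Rightarrow> ('a \<Rightarrow> real) set" where
  "realization V A = vertex_pt ` V \<union> {edge_pt u v t | u v t. A u v \<and> 0 \<le> t \<and> t \<le> 1}"

text \<open>\<open>pl_path V A l p q L\<close>: there is a piecewise linear path of length \<open>L\<close> from \<open>p\<close> to \<open>q\<close> in the
  realization, where the edge \<open>uv\<close> is an interval of length \<open>l u v\<close>.  The path metric is the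
  infimum of these lengths; it is \<open>\<infinity>\<close> if there is no path.\<close>

inductive pl_path ::
  "'a set \<Rightarrow> ('a \<Rightarrow> 'a \<Rightarrow> bool) \<Rightarrow> ('a \<Rightarrow> 'a \<Rightarrow> real) \<Rightarrow> ('a \<Rightarrow> real) \<Rightarrow> ('a \<Rightarrow> real) \<Rightarrow> real \<Rightarrow> bool"
  for V A l p where
  start: "p \<in> realization V A \<Longrightarrow> pl_path V A l p p 0"
| move: "pl_path V A l p (edge_pt u v s) L \<Longrightarrow> A u v \<Longrightarrow> s \<in> {0..1} \<Longrightarrow> t \<in> {0..1} \<Longrightarrow>
    pl_path V A l p (edge_pt u v t) (L + l u v * \<bar>s - t\<bar>)"

definition path_edist ::
  "'a set \<Rightarrow> ('a \<Rightarrow> 'a \<Rightarrow> bool) \<Rightarrow> ('a \<Rightarrow> 'a \<Rightarrow> real) \<Rightarrow> ('a \<Rightarrow> real) \<Rightarrow> ('a \<Rightarrow> real) \<Rightarrow> ereal" where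
  "path_edist V A l p q = (INF L\<in>{L. pl_path V A l p q L}. ereal L)"

definition path_dist ::
  "'a set \<Rightarrow> ('a \<Rightarrow> 'a \<Rightarrow> bool) \<Rightarrow> ('a \<Rightarrow> 'a \<Rightarrow> real) \<Rightarrow> ('a \<Rightarrow> real) \<Rightarrow> ('a \<Rightarrow> real) \<Rightarrow> real" where
  "path_dist V A l p q = real_of_ereal (path_edist V A l p q)"

abbreviation unit_length :: "'a \<Rightarrow> 'a \<Rightarrow> real" where
  "unit_length \<equiv> \<lambda>_ _. 1"


section \<open>Graphs with projections\<close>

text \<open>The collection is indexed by \<open>I\<close>, and \<open>pr Y X\<close> is the projection of \<open>X\<close> to \<open>Y\<close>.
  Diameters are extended reals, so that a bound on them is never satisfied by an unbounded set.\<close>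

definition proj_diam ::
  "('i \<Rightarrow> 'v set) \<Rightarrow> ('i \<Rightarrow> 'v \<Rightarrow> 'v \<Rightarrow> bool) \<Rightarrow> ('i \<Rightarrow> 'i \<Rightarrow> 'v set) \<Rightarrow> 'i \<Rightarrow> 'i \<Rightarrow> 'i \<Rightarrow> ereal" where
  "proj_diam V A pr Y X Z =
    (SUP x \<in> pr Y X \<union> pr Y Z. SUP z \<in> pr Y X \<union> pr Y Z.
       path_edist (V Y) (A Y) unit_length (vertex_pt x) (vertex_pt z))"

locale graphs_with_projections =
  fixes I :: "'i set"
    and V :: "'i \<Rightarrow> 'v set"
    and A :: "'i \<Rightarrow> 'v \<Rightarrow> 'v \<Rightarrow> bool"
    and pr :: "'i \<Rightarrow> 'i \<Rightarrow> 'v set"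
    and \<theta> :: nat
  assumes connected: "Y \<in> I \<Longrightarrow> connected_graph (V Y) (A Y)"
    and pr_subset: "X \<in> I \<Longrightarrow> Y \<in> I \<Longrightarrow> X \<noteq> Y \<Longrightarrow> pr Y X \<subseteq> V Y"
    and pr_nonempty: "X \<in> I \<Longrightarrow> Y \<in> I \<Longrightarrow> X \<noteq> Y \<Longrightarrow> pr Y X \<noteq> {}"
    and diam_self: "X \<in> I \<Longrightarrow> Y \<in> I \<Longrightarrow> X \<noteq> Y \<Longrightarrow> proj_diam V A pr Y X X \<le> ereal (real \<theta>)"
    and P1': "X \<in> I \<Longrightarrow> Y \<in> I \<Longrightarrow> Z \<in> I \<Longrightarrow> X \<noteq> Y \<Longrightarrow> Y \<noteq> Z \<Longrightarrow> X \<noteq> Z \<Longrightarrow>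
      proj_diam V A pr Y X Z > ereal (real \<theta>) \<Longrightarrow> pr X Y = pr X Z"
    and finite_large: "X \<in> I \<Longrightarrow> Z \<in> I \<Longrightarrow>
      finite {Y \<in> I - {X, Z}. proj_diam V A pr Y X Z > ereal (real \<theta>)}"

text \<open>Adjacency in the projection complex with vertex set \<open>I\<close>.\<close>

definition PK_adj ::
  "'i set \<Rightarrow> ('i \<Rightarrow> 'v set) \<Rightarrow> ('i \<Rightarrow> 'v \<Rightarrow> 'v \<Rightarrow> bool) \<Rightarrow> ('i \<Rightarrow> 'i \<Rightarrow> 'v set) \<Rightarrow> nat \<Rightarrow>
   'i \<Rightarrow> 'i \<Rightarrow> bool" where
  "PK_adj I V A pr K X Z \<longleftrightarrow> X \<in> I \<and> Z \<in> I \<and> X \<noteq> Z \<and>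
    (\<forall>Y \<in> I - {X, Z}. proj_diam V A pr Y X Z \<le> ereal (real K))"

text \<open>The quasi-tree of metric spaces, as a graph with vertex set \<open>Sigma I V\<close> (the disjoint union of
  the vertex sets) and two kinds of edges.\<close>

definition CK_adj ::
  "'i set \<Rightarrow> ('i \<Rightarrow> 'v set) \<Rightarrow> ('i \<Rightarrow> 'v \<Rightarrow> 'v \<Rightarrow> bool) \<Rightarrow> ('i \<Rightarrow> 'i \<Rightarrow> 'v set) \<Rightarrow> nat \<Rightarrow>
   'i \<times> 'v \<Rightarrow> 'i \<times> 'v \<Rightarrow> bool" where
  "CK_adj I V A pr K = (\<lambda>(X, x) (Y, y).
    (X \<in> I \<and> X = Y \<and> A X x y) \<or>
    (PK_adj I V A pr K X Y \<and> x \<in> pr X Y \<and> y \<in> pr Y X))"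

definition CK_length :: "nat \<Rightarrow> 'i \<times> 'v \<Rightarrow> 'i \<times> 'v \<Rightarrow> real" where
  "CK_length K = (\<lambda>(X, x) (Y, y). if X = Y then 1 else real K)"

definition CK_space ::
  "'i set \<Rightarrow> ('i \<Rightarrow> 'v set) \<Rightarrow> ('i \<Rightarrow> 'v \<Rightarrow> 'v \<Rightarrow> bool) \<Rightarrow> ('i \<Rightarrow> 'i \<Rightarrow> 'v set) \<Rightarrow> nat \<Rightarrow>
   ('i \<times> 'v \<Rightarrow> real) set" where
  "CK_space I V A pr K = realization (Sigma I V) (CK_adj I V A pr K)"

definition CK_dist ::
  "'i set \<Rightarrow> ('i \<Rightarrow> 'v set) \<Rightarrow> ('i \<Rightarrow> 'v \<Rightarrow> 'v \<Rightarrow> bool) \<Rightarrow> ('i \<Rightarrow> 'i \<Rightarrow> 'v set) \<Rightarrow> nat \<Rightarrow>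
   ('i \<times> 'v \<Rightarrow> real) \<Rightarrow> ('i \<times> 'v \<Rightarrow> real) \<Rightarrow> real" where
  "CK_dist I V A pr K = path_dist (Sigma I V) (CK_adj I V A pr K) (CK_length K)"


section \<open>Quasi-isometries and tree-graded spaces\<close>

text \<open>Requiring both sides to be metric spaces rules out disconnected graphs, for which
  \<open>path_dist\<close> takes the value 0 when there is no path.\<close>

definition quasi_isometric ::
  "real \<Rightarrow> real \<Rightarrow> 'a set \<Rightarrow> ('a \<Rightarrow> 'a \<Rightarrow> real) \<Rightarrow> 'b set \<Rightarrow> ('b \<Rightarrow> 'b \<Rightarrow> real) \<Rightarrow> bool" where
  "quasi_isometric m c M d M' d' \<longleftrightarrow>
    Metric_space M d \<and> Metric_space M' d' \<and> 1 \<le> m \<and> 0 \<le> c \<and>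
    (\<exists>f. f \<in> M \<rightarrow> M' \<and>
      (\<forall>x\<in>M. \<forall>y\<in>M. d x y / m - c \<le> d' (f x) (f y) \<and> d' (f x) (f y) \<le> m * d x y + c) \<and>
      (\<forall>z\<in>M'. \<exists>x\<in>M. d' z (f x) \<le> c))"

definition geodesic_space :: "'a set \<Rightarrow> ('a \<Rightarrow> 'a \<Rightarrow> real) \<Rightarrow> bool" where
  "geodesic_space M d \<longleftrightarrow> Metric_space M d \<and>
    (\<forall>x\<in>M. \<forall>y\<in>M. \<exists>g. g \<in> {0..d x y} \<rightarrow> M \<and> g 0 = x \<and> g (d x y) = y \<and>
      (\<forall>s\<in>{0..d x y}. \<forall>t\<in>{0..d x y}. d (g s) (g t) = \<bar>s - t\<bar>))"

definition simple_loop_in :: "'a topology \<Rightarrow> (real \<Rightarrow> 'a) \<Rightarrow> bool" where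
  "simple_loop_in X g \<longleftrightarrow> pathin X g \<and> g 0 = g 1 \<and> inj_on g {0..<1}"

definition tree_graded :: "'a set \<Rightarrow> ('a \<Rightarrow> 'a \<Rightarrow> real) \<Rightarrow> 'a set set \<Rightarrow> bool" where
  "tree_graded T d \<Q> \<longleftrightarrow> geodesic_space T d \<and>
    (\<forall>P\<in>\<Q>. P \<subseteq> T \<and> geodesic_space P d) \<and>
    (\<forall>P\<in>\<Q>. \<forall>P'\<in>\<Q>. P \<noteq> P' \<longrightarrow> (\<forall>x \<in> P \<inter> P'. \<forall>y \<in> P \<inter> P'. x = y)) \<and>
    (\<forall>g. simple_loop_in (Metric_space.mtopology T d) g \<longrightarrow> (\<exists>P\<in>\<Q>. g ` {0..1} \<subseteq> P))"

end

theory Submission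
  imports Defs
begin

text \<open>Fix a root \<open>R\<close>.  The vertices \<open>W\<close> of the projection complex with \<open>d\<^sub>W(R, X) > K\<close> form a
  finite chain, ordered by \<open>W < W'\<close> iff \<open>d\<^sub>W(R, W') > K\<close>; the parent of \<open>X\<close> is the last element of
  this chain (\<open>R\<close> if the chain is empty).  Every \<open>X\<close> is adjacent to its parent in \<open>\<P>\<^sub>K\<close>, so keeping
  only one edge between \<open>X\<close> and its parent for each \<open>X \<noteq> R\<close> yields a subgraph \<open>T\<close> of \<open>\<C>\<^sub>K\<close> on the
  same vertices in which the graphs \<open>Y\<close> are arranged along a tree.  If \<open>X\<close> and \<open>Z\<close> are adjacent in
  \<open>\<P>\<^sub>K\<close>, then \<open>K \<ge> 4\<theta>\<close> forces their chains to differ in at most two elements each, at which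
  the projections of \<open>R\<close> and \<open>X\<close> are within \<open>2K\<close>.  Hence the path in \<open>T\<close> from \<open>\<pi>\<^sub>X(Z)\<close> to
  \<open>\<pi>\<^sub>Z(X)\<close> is uniformly short, and the two path metrics on the common vertex set are comparable.\<close>

section \<open>Metric graphs\<close>

text \<open>This is why every edge of \<open>T\<close>, bridges included, has length one: below any
  bound only finitely many candidate lengths remain. (P1') always enters in the same way: if
  \<open>W\<close> separates two pieces by more than \<theta>, then each of the two sees
  \<open>W\<close> and the other one at the same projection. Such equalities turn a separation known
  only to exceed \<theta> into one exceeding \<open>K\<close>. They get started because a separation
  larger than \<open>K\<close>, hence larger than \<open>2 * \<theta>\<close>, is not the sum of two
  that are at most \<theta>. Tree-gradedness rests on two kinds of maps out of \<open>T\<close>: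
  retractions to the pieces, which show that the pieces keep their metrics, and for each bridge a
  function to \<open>[0, 1]\<close> that detects its crossing.\<close>

lemma edge_pt_0 [simp]: "edge_pt u v 0 = vertex_pt u"
  by (auto simp: edge_pt_def vertex_pt_def)

lemma edge_pt_1 [simp]: "u \<noteq> v \<Longrightarrow> edge_pt u v 1 = vertex_pt v"
  by (auto simp: edge_pt_def vertex_pt_def)

lemma edge_pt_swap: "u \<noteq> v \<Longrightarrow> edge_pt u v t = edge_pt v u (1 - t)"
  by (auto simp: edge_pt_def)

text \<open>The support of an interior point is exactly its pair of end points.\<close>

lemma edge_pt_eq_interior:
  assumes "edge_pt u v t = edge_pt u' v' t'" "u \<noteq> v" "u' \<noteq> v'" "0 < t" "t < 1"
  shows "u' = u \<and> v' = v \<and> t' = t \<or> u' = v \<and> v' = u \<and> t' = 1 - t"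
  using fun_cong[OF assms(1), of u] fun_cong[OF assms(1), of v]
    fun_cong[OF assms(1), of u'] fun_cong[OF assms(1), of v'] assms(2-)
  by (auto simp: edge_pt_def split: if_splits)

lemma edge_pt_eq_vertex_pt:
  assumes "edge_pt u v t = vertex_pt w" "u \<noteq> v"
  shows "u = w \<and> t = 0 \<or> v = w \<and> t = 1"
  using fun_cong[OF assms(1), of u] fun_cong[OF assms(1), of v] assms(2-)
  by (auto simp: edge_pt_def vertex_pt_def split: if_splits)

text \<open>Interpolating a 1-Lipschitz function on the vertices gives a 1-Lipschitz function on the
  realization, hence a lower bound for the path metric.  (The sum is junk for points with infinite
  support, which do not occur in a realization.)\<close>

definition interp :: "('a \<Rightarrow> real) \<Rightarrow> ('a \<Rightarrow> real) \<Rightarrow> real" where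
  "interp \<phi> p = (\<Sum>w | p w \<noteq> 0. p w * \<phi> w)"

lemma interp_superset:
  assumes "finite S" "{w. p w \<noteq> 0} \<subseteq> S"
  shows "interp \<phi> p = (\<Sum>w\<in>S. p w * \<phi> w)"
  unfolding interp_def using assms by (intro sum.mono_neutral_left) auto

lemma interp_vertex_pt [simp]: "interp \<phi> (vertex_pt u) = \<phi> u"
  by (subst interp_superset[of "{u}"]) (auto simp: vertex_pt_def)

lemma interp_edge_pt: "u \<noteq> v \<Longrightarrow> interp \<phi> (edge_pt u v t) = (1 - t) * \<phi> u + t * \<phi> v"
  by (subst interp_superset[of "{u, v}"]) (auto simp: edge_pt_def)

text \<open>Pushforward of barycentric coordinates, that is, the affine extension of the vertex map
  \<rho>: the coordinate at \<open>v\<close> is the mass on the fibre of \<rho> over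
  \<open>v\<close>.\<close>

definition push :: "('a \<Rightarrow> 'b) \<Rightarrow> ('a \<Rightarrow> real) \<Rightarrow> 'b \<Rightarrow> real" where
  "push \<rho> p = (\<lambda>v. interp (\<lambda>w. of_bool (\<rho> w = v)) p)"

lemma push_vertex_pt [simp]: "push \<rho> (vertex_pt u) = vertex_pt (\<rho> u)"
  by (auto simp: push_def vertex_pt_def[of "\<rho> u"])

lemma push_edge_pt:
  "u \<noteq> v \<Longrightarrow> push \<rho> (edge_pt u v t) =
     (if \<rho> u = \<rho> v then vertex_pt (\<rho> u) else edge_pt (\<rho> u) (\<rho> v) t)"
  by (rule ext) (simp add: push_def interp_edge_pt, auto simp: vertex_pt_def edge_pt_def)

text \<open>The lower bound on the edge lengths makes every barycentric coordinate 1-Lipschitz, so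
  distinct points have positive distance.\<close>

locale metric_graph =
  fixes V :: "'a set" and A :: "'a \<Rightarrow> 'a \<Rightarrow> bool" and l :: "'a \<Rightarrow> 'a \<Rightarrow> real"
  assumes connected: "connected_graph V A"
    and length_ge_1: "A u v \<Longrightarrow> 1 \<le> l u v"
begin

abbreviation "points \<equiv> realization V A"
abbreviation "d \<equiv> path_dist V A l"
abbreviation "walk \<equiv> pl_path V A l"

lemma adjD: "A u v \<Longrightarrow> u \<in> V" "A u v \<Longrightarrow> v \<in> V" "A u v \<Longrightarrow> u \<noteq> v" "A u v \<Longrightarrow> A v u"
  using connected unfolding connected_graph_def simple_graph_def by blast+

lemma edge_pt_in: "A u v \<Longrightarrow> t \<in> {0..1} \<Longrightarrow> edge_pt u v t \<in> points"
  unfolding realization_def by auto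

lemma vertex_pt_in: "u \<in> V \<Longrightarrow> vertex_pt u \<in> points"
  unfolding realization_def by auto

lemma points_cases:
  assumes "p \<in> points"
  obtains u where "u \<in> V" "p = vertex_pt u"
  | u v t where "A u v" "t \<in> {0..1}" "p = edge_pt u v t"
  using assms unfolding realization_def by fastforce

lemma path_props: "walk p q L \<Longrightarrow> p \<in> points \<and> q \<in> points \<and> 0 \<le> L"
proof (induction rule: pl_path.induct)
  case (move u v s L t)
  then show ?case using edge_pt_in length_ge_1[of u v] by simp
qed auto

lemma path_trans:
  assumes "walk q r M" "walk p q L" shows "walk p r (L + M)"
  using assms
proof (induction rule: pl_path.induct)
  case (move u v s M t)
  then show ?case using pl_path.move[of V A l p u v s "L + M" t] by (simp add: add.assoc)
qed auto

lemma path_edge: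
  "A u v \<Longrightarrow> s \<in> {0..1} \<Longrightarrow> t \<in> {0..1} \<Longrightarrow> walk (edge_pt u v s) (edge_pt u v t) (l u v * \<bar>s - t\<bar>)"
  using pl_path.move[where p="edge_pt u v s" and s=s and t=t, OF pl_path.start[OF edge_pt_in]]
  by fastforce

lemma path_sym: "walk p q L \<Longrightarrow> walk q p L"
proof (induction rule: pl_path.induct)
  case (move u v s L t)
  then show ?case using path_trans[OF move.IH path_edge[of u v t s]]
    by (simp add: add.commute abs_minus_commute)
qed (auto intro: pl_path.start)

lemma path_to_vertex:
  assumes "p \<in> points" obtains u L where "u \<in> V" "walk p (vertex_pt u) L"
  using assms
proof (cases p rule: points_cases)
  case (1 u)
  then show ?thesis using that[of u] pl_path.start[OF assms] by auto
next
  case (2 u v t)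
  then show ?thesis using that[of u] path_edge[of u v t 0] adjD[of u v] by auto
qed

lemma path_vertices:
  assumes "u \<in> V" "v \<in> V" shows "\<exists>L. walk (vertex_pt u) (vertex_pt v) L"
proof -
  have "A\<^sup>*\<^sup>* u v" using assms connected unfolding connected_graph_def by blast
  then show ?thesis
  proof induction
    case base
    then show ?case using pl_path.start[OF vertex_pt_in] assms by blast
  next
    case (step v w)
    then obtain L where "walk (vertex_pt u) (vertex_pt v) L" by blast
    then show ?case using path_trans[OF path_edge[of v w 0 1]] step(2) adjD[of v w] by auto
  qed
qed

lemma path_exists: assumes "p \<in> points" "q \<in> points" obtains L where "walk p q L"
proof -
  obtain u L where u: "u \<in> V" "walk p (vertex_pt u) L" using path_to_vertex[OF assms(1)] .
  obtain v M where v: "v \<in> V" "walk q (vertex_pt v) M" using path_to_vertex[OF assms(2)] .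
  from path_vertices[OF u(1) v(1)] show ?thesis
    using path_trans[OF path_sym[OF v(2)]] path_trans[OF _ u(2)] that by blast
qed

lemma edist_eq:
  assumes "p \<in> points" "q \<in> points"
  shows "path_edist V A l p q = ereal (d p q)"
proof -
  obtain L where L: "walk p q L" using path_exists assms by blast
  have "path_edist V A l p q \<le> ereal L"
    unfolding path_edist_def using L by (intro INF_lower) auto
  moreover have "0 \<le> path_edist V A l p q"
    unfolding path_edist_def using path_props by (intro INF_greatest) auto
  ultimately show ?thesis unfolding path_dist_def by (cases "path_edist V A l p q") auto
qed

lemma dist_le: assumes "walk p q L" shows "d p q \<le> L"
proof -
  have "path_edist V A l p q \<le> ereal L"
    unfolding path_edist_def using assms by (intro INF_lower) auto
  then show ?thesis using edist_eq path_props[OF assms] by simp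
qed

lemma dist_ge:
  assumes "p \<in> points" "q \<in> points" "\<And>L. walk p q L \<Longrightarrow> B \<le> L" shows "B \<le> d p q"
proof -
  have "ereal B \<le> path_edist V A l p q"
    unfolding path_edist_def using assms(3) by (intro INF_greatest) auto
  then show ?thesis using edist_eq assms by simp
qed

lemma path_lipschitz:
  assumes "walk p q L"
    and "\<And>u v s t. A u v \<Longrightarrow> s \<in> {0..1} \<Longrightarrow> t \<in> {0..1} \<Longrightarrow>
      \<bar>F (edge_pt u v s) - F (edge_pt u v t)\<bar> \<le> l u v * \<bar>s - t\<bar>"
  shows "\<bar>F p - F q\<bar> \<le> L"
  using assms(1)
proof (induction rule: pl_path.induct)
  case (move u v s L t)
  then show ?case using assms(2)[of u v s t] by linarith
qed auto

lemma lipschitz: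
  assumes "p \<in> points" "q \<in> points"
    and "\<And>u v s t. A u v \<Longrightarrow> s \<in> {0..1} \<Longrightarrow> t \<in> {0..1} \<Longrightarrow>
      \<bar>F (edge_pt u v s) - F (edge_pt u v t)\<bar> \<le> l u v * \<bar>s - t\<bar>"
  shows "\<bar>F p - F q :: real\<bar> \<le> d p q"
  using dist_ge[OF assms(1,2)] path_lipschitz[where F=F] assms(3) by blast

lemma interp_lipschitz:
  assumes "p \<in> points" "q \<in> points" and "\<And>u v. A u v \<Longrightarrow> \<bar>\<phi> u - \<phi> v\<bar> \<le> l u v"
  shows "\<bar>interp \<phi> p - interp \<phi> q\<bar> \<le> d p q"
proof (rule lipschitz[OF assms(1,2)])
  fix u v s t assume A: "A u v"
  have "interp \<phi> (edge_pt u v s) - interp \<phi> (edge_pt u v t) = (\<phi> u - \<phi> v) * (t - s)"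
    using interp_edge_pt[OF adjD(3)[OF A]] by (simp add: algebra_simps)
  then show "\<bar>interp \<phi> (edge_pt u v s) - interp \<phi> (edge_pt u v t)\<bar> \<le> l u v * \<bar>s - t\<bar>"
    using assms(3)[OF A] by (simp add: abs_mult abs_minus_commute mult_right_mono)
qed

lemma coordinate_lipschitz:
  assumes "p \<in> points" "q \<in> points" shows "\<bar>p w - q w\<bar> \<le> d p q"
proof (rule lipschitz[OF assms, where F="\<lambda>p. p w"])
  fix u v s t assume A: "A u v"
  have "1 * \<bar>s - t\<bar> \<le> l u v * \<bar>s - t\<bar>" using length_ge_1[OF A] by (intro mult_right_mono) auto
  then show "\<bar>edge_pt u v s w - edge_pt u v t w\<bar> \<le> l u v * \<bar>s - t\<bar>"
    using length_ge_1[OF A] by (auto simp: edge_pt_def)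
qed

lemma Metric: "Metric_space points d"
proof
  fix p q
  have "0 \<le> path_edist V A l p q"
    unfolding path_edist_def using path_props by (intro INF_greatest) auto
  then show "0 \<le> d p q" unfolding path_dist_def by (simp add: real_of_ereal_pos)
  show "d p q = d q p"
    unfolding path_dist_def path_edist_def using path_sym[of p q] path_sym[of q p]
    by (intro arg_cong[where f=real_of_ereal] INF_cong) auto
next
  fix p q assume pq: "p \<in> points" "q \<in> points"
  show "d p q = 0 \<longleftrightarrow> p = q"
  proof
    assume "d p q = 0"
    then show "p = q" using coordinate_lipschitz[OF pq] by fastforce
  next
    assume "p = q"
    then have "d p q \<le> 0" "0 \<le> d p q"
      using dist_le[OF pl_path.start] dist_ge[OF pq, of 0] path_props pq by auto
    then show "d p q = 0" by simp
  qed
next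
  fix p q r assume pqr: "p \<in> points" "q \<in> points" "r \<in> points"
  have "d p r - M \<le> d p q" if "walk q r M" for M
  proof (rule dist_ge[OF pqr(1,2)])
    fix L assume "walk p q L"
    then show "d p r - M \<le> L" using dist_le[OF path_trans[OF that]] by fastforce
  qed
  then have "d p r - d p q \<le> d q r"
    by (intro dist_ge[OF pqr(2,3)]) (simp add: algebra_simps)
  then show "d p r \<le> d p q + d q r" by simp
qed

sublocale Metric_space points d
  by (rule Metric)

lemma dist_edge: "A u v \<Longrightarrow> s \<in> {0..1} \<Longrightarrow> t \<in> {0..1} \<Longrightarrow>
    d (edge_pt u v s) (edge_pt u v t) \<le> l u v * \<bar>s - t\<bar>"
  by (rule dist_le[OF path_edge])

lemma dist_adjacent: "A u v \<Longrightarrow> d (vertex_pt u) (vertex_pt v) \<le> l u v"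
  using dist_edge[of u v 0 1] adjD[of u v] by simp

lemma near_vertex:
  assumes "p \<in> points" "\<And>u v. A u v \<Longrightarrow> l u v \<le> c" "0 \<le> c"
  obtains u where "u \<in> V" "d p (vertex_pt u) \<le> c"
  using assms(1)
proof (cases p rule: points_cases)
  case (1 u)
  then show ?thesis using that[of u] assms by simp
next
  case (2 u v t)
  have "l u v * \<bar>t - 0\<bar> \<le> c * 1" using assms(2)[OF 2(1)] 2(2) assms(3) length_ge_1[OF 2(1)]
    by (intro mult_mono) auto
  then show ?thesis using that[of u] dist_edge[OF 2(1,2), of 0] 2 adjD(1)[OF 2(1)] by simp
qed

text \<open>Links the inductive walks to the parametrised curves in the definition of a geodesic
  space.\<close>

lemma path_to_lipschitz_curve:
  assumes "walk p q L"
  obtains g where "g \<in> {0..L} \<rightarrow> points" "g 0 = p" "g L = q"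
    "\<And>s t. 0 \<le> s \<Longrightarrow> s \<le> t \<Longrightarrow> t \<le> L \<Longrightarrow> d (g s) (g t) \<le> t - s"
proof -
  have "\<exists>g. g \<in> {0..L} \<rightarrow> points \<and> g 0 = p \<and> g L = q \<and>
    (\<forall>s t. 0 \<le> s \<and> s \<le> t \<and> t \<le> L \<longrightarrow> d (g s) (g t) \<le> t - s)"
    using assms
  proof (induction rule: pl_path.induct)
    case start
    then show ?case by (intro exI[of _ "\<lambda>_. p"]) auto
  next
    case (move u v a L b)
    define M where "M = l u v * \<bar>a - b\<bar>"
    have L: "0 \<le> L" and M: "0 \<le> M"
      using path_props[OF move(1)] length_ge_1[OF move(2)] unfolding M_def by auto
    from move(5) obtain g where g: "g \<in> {0..L} \<rightarrow> points" "g 0 = p" "g L = edge_pt u v a"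
      "\<And>s t. 0 \<le> s \<Longrightarrow> s \<le> t \<Longrightarrow> t \<le> L \<Longrightarrow> d (g s) (g t) \<le> t - s" by blast
    \<comment> \<open>Parametrisation by arc length. If \<open>M = 0\<close> then
      \<open>a = b\<close>, as \<open>l u v\<close> is at least 1, and \<open>e\<close> is
      constant.\<close>
    define e where "e = (\<lambda>r. edge_pt u v (a + (r / M) * (b - a)))"
    have par: "a + (r / M) * (b - a) \<in> {0..1}" if "0 \<le> r" "r \<le> M" for r
    proof -
      have "0 \<le> r / M" "r / M \<le> 1" using that M by (auto simp: divide_le_eq_1)
      moreover have "a + r / M * (b - a) = (1 - r / M) * a + (r / M) * b" by algebra
      moreover have "0 \<le> (1 - r / M) * a + (r / M) * b"
        using calculation(1,2) move(3,4) by (intro add_nonneg_nonneg mult_nonneg_nonneg) auto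
      ultimately show ?thesis
        using move(3,4) convex_bound_le[of a 1 b "1 - r / M" "r / M"] by simp
    qed
    have eX: "e r \<in> points" if "0 \<le> r" "r \<le> M" for r
      unfolding e_def by (intro edge_pt_in move par that)
    have e0: "e 0 = edge_pt u v a" by (simp add: e_def)
    have eM: "e M = edge_pt u v b"
      by (cases "M = 0") (use length_ge_1[OF move(2)] in \<open>auto simp: e_def M_def\<close>)
    have ed: "d (e s) (e t) \<le> t - s" if "0 \<le> s" "s \<le> t" "t \<le> M" for s t
    proof (cases "M = 0")
      case True
      then have "s = t" using that by simp
      then show ?thesis using that eX[of s] by simp
    next
      case False
      have "d (e s) (e t) \<le> l u v * \<bar>(a + (s / M) * (b - a)) - (a + (t / M) * (b - a))\<bar>"
        unfolding e_def using that by (intro dist_edge move par) auto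
      also have "(a + (s / M) * (b - a)) - (a + (t / M) * (b - a)) = (t - s) / M * (a - b)"
        by (simp add: algebra_simps diff_divide_distrib)
      also have "l u v * \<bar>(t - s) / M * (a - b)\<bar> = (t - s) / M * M"
        using that M length_ge_1[OF move(2)] unfolding M_def by (simp add: abs_mult)
      finally show ?thesis using False by simp
    qed
    define h where "h = (\<lambda>r. if r \<le> L then g r else e (r - L))"
    have hX: "h r \<in> points" if "0 \<le> r" "r \<le> L + M" for r
      using that g(1) eX[of "r - L"] by (auto simp: h_def)
    have hd: "d (h s) (h t) \<le> t - s" if st: "0 \<le> s" "s \<le> t" "t \<le> L + M" for s t
    proof -
      consider "t \<le> L" | "s \<le> L" "L < t" | "L < s" by linarith
      then show ?thesis
      proof cases
        case 1
        then show ?thesis using st g(4) by (simp add: h_def)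
      next
        case 2
        have "d (h s) (h t) \<le> d (h s) (h L) + d (h L) (h t)"
          using 2 L M st by (intro triangle hX) auto
        moreover have "d (h s) (h L) \<le> L - s" using g(4) 2 st by (simp add: h_def)
        moreover have "d (h L) (h t) \<le> t - L"
          using ed[of 0 "t - L"] 2 st g(3) e0 by (simp add: h_def)
        ultimately show ?thesis by simp
      next
        case 3
        then show ?thesis using ed[of "s - L" "t - L"] st by (simp add: h_def)
      qed
    qed
    have "h (L + M) = edge_pt u v b"
      using eM e0 g(3) M by (cases "M = 0") (auto simp: h_def)
    moreover have "h 0 = p" using g(2) L by (simp add: h_def)
    ultimately show ?case using hX hd unfolding M_def[symmetric] by (intro exI[of _ h]) auto
  qed
  then show ?thesis using that by blast
qed

text \<open>A 1-Lipschitz curve on \<open>[0, d p q]\<close> from \<open>p\<close> to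
  \<open>q\<close> is isometric, since a loss on any subinterval would make \<open>p\<close> and
  \<open>q\<close> closer than \<open>d p q\<close>.\<close>

lemma geodesicI:
  assumes "\<And>p q. p \<in> points \<Longrightarrow> q \<in> points \<Longrightarrow> walk p q (d p q)"
  shows "geodesic_space points d"
  unfolding geodesic_space_def
proof (intro conjI Metric ballI)
  fix p q assume pq: "p \<in> points" "q \<in> points"
  define L where "L = d p q"
  obtain g where g: "g \<in> {0..L} \<rightarrow> points" "g 0 = p" "g L = q"
    and gd: "\<And>s t. 0 \<le> s \<Longrightarrow> s \<le> t \<Longrightarrow> t \<le> L \<Longrightarrow> d (g s) (g t) \<le> t - s"
    using path_to_lipschitz_curve[OF assms[OF pq, folded L_def]] by blast
  have *: "d (g s) (g t) = t - s" if "0 \<le> s" "s \<le> t" "t \<le> L" for s t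
  proof -
    have "L \<le> d p (g s) + d (g s) (g t) + d (g t) q"
      unfolding L_def using triangle[of p "g s" q] triangle[of "g s" "g t" q] pq that g(1) by fastforce
    then show ?thesis using gd[of 0 s] gd[OF that] gd[of t L] that g by simp
  qed
  have "d (g s) (g t) = \<bar>s - t\<bar>" if "s \<in> {0..L}" "t \<in> {0..L}" for s t
    using *[of s t] *[of t s] that commute[of "g s" "g t"] by (cases "s \<le> t") auto
  then show "\<exists>g. g \<in> {0..d p q} \<rightarrow> points \<and> g 0 = p \<and> g (d p q) = q \<and>
      (\<forall>s\<in>{0..d p q}. \<forall>t\<in>{0..d p q}. d (g s) (g t) = \<bar>s - t\<bar>)"
    using g unfolding L_def by (intro exI[of _ g]) auto
qed

end

section \<open>Simplicial maps between metric graphs\<close>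

lemma push_path:
  assumes G: "metric_graph V A l" and G': "metric_graph V' A' l'" and "0 \<le> c"
    and V: "\<And>u. u \<in> V \<Longrightarrow> \<rho> u \<in> V'"
    and E: "\<And>u v. A u v \<Longrightarrow> \<rho> u = \<rho> v \<or> A' (\<rho> u) (\<rho> v) \<and> l' (\<rho> u) (\<rho> v) \<le> c * l u v"
    and "pl_path V A l p q L"
  shows "\<exists>L'\<le>c * L. pl_path V' A' l' (push \<rho> p) (push \<rho> q) L'"
  using assms(6)
proof (induction rule: pl_path.induct)
  case start
  interpret G: metric_graph V A l by fact
  interpret G': metric_graph V' A' l' by fact
  have "push \<rho> p \<in> realization V' A'"
    using start
  proof (cases p rule: G.points_cases)
    case (1 u)
    then show ?thesis using V G'.vertex_pt_in by simp
  next
    case (2 u v t)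
    then show ?thesis
      using G'.vertex_pt_in G'.edge_pt_in V E[OF 2(1)] G.adjD[OF 2(1)] by (auto simp: push_edge_pt)
  qed
  then show ?case using pl_path.start by fastforce
next
  case (move u v s L t)
  note uv = metric_graph.adjD[OF G move(2)]
  from move(5) obtain L' where L': "L' \<le> c * L"
    "pl_path V' A' l' (push \<rho> p) (push \<rho> (edge_pt u v s)) L'" by blast
  have l: "0 \<le> l u v" using metric_graph.length_ge_1[OF G move(2)] by simp
  show ?case
  proof (cases "\<rho> u = \<rho> v")
    case True
    then have "push \<rho> (edge_pt u v t) = push \<rho> (edge_pt u v s)" using uv by (simp add: push_edge_pt)
    moreover have "c * L \<le> c * (L + l u v * \<bar>s - t\<bar>)" using l \<open>0 \<le> c\<close> by (intro mult_left_mono) auto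
    ultimately show ?thesis using L' by (intro exI[of _ L']) auto
  next
    case False
    then have E': "A' (\<rho> u) (\<rho> v)" "l' (\<rho> u) (\<rho> v) \<le> c * l u v" using E[OF move(2)] by auto
    have "l' (\<rho> u) (\<rho> v) * \<bar>s - t\<bar> \<le> c * l u v * \<bar>s - t\<bar>" using E' by (intro mult_right_mono) auto
    then have "L' + l' (\<rho> u) (\<rho> v) * \<bar>s - t\<bar> \<le> c * (L + l u v * \<bar>s - t\<bar>)"
      using L'(1) by (simp add: algebra_simps)
    moreover have "pl_path V' A' l' (push \<rho> p) (push \<rho> (edge_pt u v t)) (L' + l' (\<rho> u) (\<rho> v) * \<bar>s - t\<bar>)"
      using pl_path.move[of V' A' l' "push \<rho> p" "\<rho> u" "\<rho> v" s L' t] L'(2) E'(1) uv False move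
      by (simp add: push_edge_pt)
    ultimately show ?thesis by blast
  qed
qed

lemma push_in:
  assumes G: "metric_graph V A l" and G': "metric_graph V' A' l'" and "0 \<le> c"
    and "\<And>u. u \<in> V \<Longrightarrow> \<rho> u \<in> V'"
    and "\<And>u v. A u v \<Longrightarrow> \<rho> u = \<rho> v \<or> A' (\<rho> u) (\<rho> v) \<and> l' (\<rho> u) (\<rho> v) \<le> c * l u v"
    and "p \<in> realization V A"
  shows "push \<rho> p \<in> realization V' A'"
  using push_path[OF assms(1-5) pl_path.start[OF assms(6)]] metric_graph.path_props[OF G'] by blast

text \<open>Collapsed edges are allowed so that this covers the retractions of \<open>T\<close> to
  its pieces as well as their inclusions (\<open>c = 1\<close>), and also the identity on vertices
  from \<open>T\<close> to \<open>\<C>\<^sub>K\<close> (\<open>c = K\<close>).\<close>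

lemma push_dist:
  assumes G: "metric_graph V A l" and G': "metric_graph V' A' l'" and "0 < c"
    and "\<And>u. u \<in> V \<Longrightarrow> \<rho> u \<in> V'"
    and "\<And>u v. A u v \<Longrightarrow> \<rho> u = \<rho> v \<or> A' (\<rho> u) (\<rho> v) \<and> l' (\<rho> u) (\<rho> v) \<le> c * l u v"
    and "p \<in> realization V A" "q \<in> realization V A"
  shows "path_dist V' A' l' (push \<rho> p) (push \<rho> q) \<le> c * path_dist V A l p q"
proof -
  have "path_dist V' A' l' (push \<rho> p) (push \<rho> q) / c \<le> path_dist V A l p q"
  proof (rule metric_graph.dist_ge[OF G assms(6,7)])
    fix L assume "pl_path V A l p q L"
    from push_path[OF assms(1,2) _ assms(4,5) this] obtain L' where
      "L'\<le>c * L" "pl_path V' A' l' (push \<rho> p) (push \<rho> q) L'" using \<open>0 < c\<close> by auto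
    then show "path_dist V' A' l' (push \<rho> p) (push \<rho> q) / c \<le> L"
      using metric_graph.dist_le[OF G'] \<open>0 < c\<close> by (fastforce simp: divide_le_eq mult.commute)
  qed
  then show ?thesis using \<open>0 < c\<close> by (simp add: divide_le_eq mult.commute)
qed

section \<open>Geodesics in graphs with edges of length one\<close>

context metric_graph
begin

lemma walk_endpoints_on_edges:
  assumes "walk p q L" "p \<noteq> q"
  obtains a b r u v s where "A a b" "r \<in> {0..1}" "p = edge_pt a b r"
    "A u v" "s \<in> {0..1}" "q = edge_pt u v s"
proof -
  have "p \<noteq> q \<longrightarrow> (\<exists>a b r u v s. A a b \<and> r \<in> {0..1} \<and> p = edge_pt a b r \<and>
      A u v \<and> s \<in> {0..1} \<and> q = edge_pt u v s)"
    using assms(1)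
  proof (induction rule: pl_path.induct)
    case (move u v s L t)
    then show ?case by (cases "p = edge_pt u v s") blast+
  qed simp
  then show ?thesis using assms(2) that by blast
qed

text \<open>A shortest path is either contained in an edge or passes through an end point of the edge of
  \<open>p\<close> and of the edge of \<open>q\<close>, so its length lies in one of four cosets of the integers.  The infimum
  of the lengths is therefore attained.\<close>

lemma walk_reduced:
  assumes unit: "\<And>u v. A u v \<Longrightarrow> l u v = 1"
    and p: "A a b" "r \<in> {0..1}" "p = edge_pt a b r"
    and "walk p q L" and q: "A u v" "s \<in> {0..1}" "q = edge_pt u v s"
  shows "\<exists>M\<le>L. walk p q M \<and> (\<exists>n::int. M \<in> {n + r + s, n + r - s, n - r + s, n - r - s})"
proof -
  \<comment> \<open>Lengths of reduced walks from \<open>p\<close> to a vertex: the sign of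
    \<open>r\<close> tells through which end point the walk leaves the edge of
    \<open>p\<close>.\<close>
  define Z where "Z = {M. \<exists>n::int. M = n + r \<or> M = n - r}"
  define S where "S = (\<lambda>w. {M \<in> Z. walk p (vertex_pt w) M})"
  \<comment> \<open>A reduced walk to \<open>edge_pt u v s\<close> arrives through \<open>u\<close>,
    arrives through \<open>v\<close>, or runs straight inside an edge containing
    \<open>p\<close>.\<close>
  define Inv where "Inv = (\<lambda>u v s L. (\<exists>M\<in>S u. M + s \<le> L) \<or> (\<exists>M\<in>S v. M + (1 - s) \<le> L) \<or>
    (\<exists>r'\<in>{0..1}. p = edge_pt u v r' \<and> \<bar>r' - s\<bar> \<le> L))"
  have Z1: "M + 1 \<in> Z" if "M \<in> Z" for M
  proof -
    from that obtain n :: int where "M = n + r \<or> M = n - r" unfolding Z_def by blast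
    then show ?thesis unfolding Z_def by (intro CollectI exI[of _ "n + 1"]) auto
  qed
  \<comment> \<open>The parameter of \<open>p\<close> stays in \<open>Z\<close> for every edge
    containing it: it is \<open>r\<close> or \<open>1 - r\<close> for an interior point, and all
    parameters are integers if \<open>p\<close> is a vertex.\<close>
  have Zrep: "r' \<in> Z" if r': "A u v" "r' \<in> {0..1}" "p = edge_pt u v r'" for u v r'
  proof (cases "0 < r \<and> r < 1")
    case True
    then have "r' = r \<or> r' = 1 - r"
      using edge_pt_eq_interior[of a b r u v r'] p r' adjD(3) by blast
    then have "r' = of_int 0 + r \<or> r' = of_int 1 - r" by auto
    then show ?thesis unfolding Z_def by blast
  next
    case False
    then have "r = 0 \<or> r = 1" using p(2) by auto
    then have "\<exists>w. p = vertex_pt w" using p(3) adjD(3)[OF p(1)] by auto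
    then have "r' = 0 \<or> r' = 1" using edge_pt_eq_vertex_pt r'(3) adjD(3)[OF r'(1)] by metis
    moreover have "r' = of_int (\<lfloor>r'\<rfloor> - \<lfloor>r\<rfloor>) + r"
      using \<open>r = 0 \<or> r = 1\<close> calculation by auto
    ultimately show ?thesis unfolding Z_def by blast
  qed
  have Inv_swap: "Inv v u (1 - s) L" if "Inv u v s L" "A u v" for u v s L
  proof -
    have "\<exists>r''\<in>{0..1}. p = edge_pt v u r'' \<and> \<bar>r'' - (1 - s)\<bar> \<le> L"
      if "r' \<in> {0..1}" "p = edge_pt u v r'" "\<bar>r' - s\<bar> \<le> L" for r'
      using that edge_pt_swap[OF adjD(3)[OF \<open>A u v\<close>]] by (intro bexI[of _ "1 - r'"]) auto
    moreover have "1 - (1 - s) = s" by simp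
    ultimately show ?thesis using that(1) unfolding Inv_def by metis
  qed
  have Inv_0: "\<exists>M\<in>S u. M \<le> L" if I: "Inv u v 0 L" and uv: "A u v" for u v L
  proof -
    consider M where "M \<in> S u" "M \<le> L" | M where "M \<in> S v" "M + 1 \<le> L"
      | r' where "r' \<in> {0..1}" "p = edge_pt u v r'" "r' \<le> L"
      using I unfolding Inv_def by fastforce
    then show ?thesis
    proof cases
      case (2 M)
      have "walk (vertex_pt v) (vertex_pt u) 1"
        using path_edge[of u v 1 0] uv adjD(3)[OF uv] unit[OF uv] by simp
      then have "M + 1 \<in> S u" using path_trans[of "vertex_pt v" "vertex_pt u" 1 p M] 2(1) Z1
        unfolding S_def by simp
      then show ?thesis using 2 by blast
    next
      case (3 r')
      have "walk p (vertex_pt u) r'"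
        using path_edge[of u v r' 0] uv unit[OF uv] 3 by simp
      then show ?thesis using 3 Zrep[OF uv 3(1,2)] unfolding S_def by blast
    qed auto
  qed
  \<comment> \<open>All representations of the end point are needed, since a walk may leave a vertex
    along another edge than the one it came by.\<close>
  have Inv: "\<forall>u v s. A u v \<and> s \<in> {0..1} \<and> q = edge_pt u v s \<longrightarrow> Inv u v s L"
    using \<open>walk p q L\<close>
  proof (induction rule: pl_path.induct)
    case start
    then show ?case unfolding Inv_def by force
  next
    case (move u v s L t)
    have "Inv u v s L" using move by blast
    then have I: "Inv u v t (L + l u v * \<bar>s - t\<bar>)"
      unfolding Inv_def unit[OF move(2)] by (smt (verit) mult_1)
    show ?case
    proof (intro allI impI, elim conjE)
      fix u' v' t' assume uv': "A u' v'" "t' \<in> {0..1}" and eq: "edge_pt u v t = edge_pt u' v' t'"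
      have vert: "Inv u' v' t' L'" if "\<exists>M\<in>S w. M \<le> L'" "edge_pt u v t = vertex_pt w" for w L'
        using edge_pt_eq_vertex_pt[of u' v' t' w] that eq adjD(3)[OF uv'(1)] unfolding Inv_def by auto
      consider "t = 0" | "t = 1" | "0 < t" "t < 1" using move(4) by fastforce
      then show "Inv u' v' t' (L + l u v * \<bar>s - t\<bar>)"
      proof cases
        case 1
        then show ?thesis using vert[of u] Inv_0[OF _ move(2)] I by simp
      next
        case 2
        then show ?thesis
          using vert[of v] Inv_0[of v u] Inv_swap[OF I move(2)] adjD(3,4)[OF move(2)] by simp
      next
        case 3
        then show ?thesis
          using edge_pt_eq_interior[OF eq adjD(3)[OF move(2)] adjD(3)[OF uv'(1)]]
            Inv_swap[OF I move(2)] I by auto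
      qed
    qed
  qed
  then have "Inv u v s L" using q by blast
  then consider M where "M \<in> S u" "M + s \<le> L" | M where "M \<in> S v" "M + (1 - s) \<le> L"
    | r' where "r' \<in> {0..1}" "p = edge_pt u v r'" "\<bar>r' - s\<bar> \<le> L"
    unfolding Inv_def by blast
  then show ?thesis
  proof cases
    case (1 M)
    have "walk p q (M + s)"
      using path_trans[OF path_edge[OF q(1) _ q(2), of 0], of p M] 1 q unit[OF q(1)]
      unfolding S_def by simp
    moreover obtain n :: int where "M = n + r \<or> M = n - r" using 1 unfolding S_def Z_def by blast
    ultimately show ?thesis using 1(2) by (intro exI[of _ "M + s"]) auto
  next
    case (2 M)
    have "walk p q (M + (1 - s))"
      using path_trans[OF path_edge[OF q(1) _ q(2), of 1], of p M] 2 q unit[OF q(1)] adjD(3)[OF q(1)]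
      unfolding S_def by simp
    moreover obtain n :: int where "M = n + r \<or> M = n - r" using 2 unfolding S_def Z_def by blast
    then have "M + (1 - s) = of_int (n + 1) + r - s \<or> M + (1 - s) = of_int (n + 1) - r - s" by auto
    ultimately show ?thesis using 2(2) by blast
  next
    case (3 r')
    have "walk p q \<bar>r' - s\<bar>"
      using path_edge[OF q(1) 3(1) q(2)] 3 q unit[OF q(1)] by simp
    moreover obtain n :: int where "r' = n + r \<or> r' = n - r" using Zrep[OF q(1) 3(1,2)]
      unfolding Z_def by blast
    then have "\<exists>n::int. \<bar>r' - s\<bar> \<in> {n + r + s, n + r - s, n - r + s, n - r - s}"
    proof (cases "s \<le> r'")
      case True
      then show ?thesis using \<open>r' = n + r \<or> r' = n - r\<close> by (intro exI[of _ n]) auto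
    next
      case False
      then show ?thesis using \<open>r' = n + r \<or> r' = n - r\<close> by (intro exI[of _ "- n"]) auto
    qed
    ultimately show ?thesis using 3(3) by blast
  qed
qed

lemma dist_attained:
  assumes unit: "\<And>u v. A u v \<Longrightarrow> l u v = 1" and "p \<in> points" "q \<in> points"
  shows "walk p q (d p q)"
proof (cases "p = q")
  case True
  then show ?thesis using pl_path.start assms by fastforce
next
  case False
  obtain L where L: "walk p q L" using path_exists assms by blast
  then obtain a b r u v s where p: "A a b" "r \<in> {0..1}" "p = edge_pt a b r"
    and q: "A u v" "s \<in> {0..1}" "q = edge_pt u v s"
    using walk_endpoints_on_edges[OF L False] by metis
  have red: "\<exists>M\<le>L. walk p q M \<and> (\<exists>n::int. M \<in> {n + r + s, n + r - s, n - r + s, n - r - s})"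
    if "walk p q L" for L
    using walk_reduced[OF _ p that q] unit by blast
  define C where "C = {M. walk p q M \<and> (\<exists>n::int. M \<in> {n + r + s, n + r - s, n - r + s, n - r - s})}"
  obtain B where B: "B \<in> C" using red[OF L] unfolding C_def by blast
  \<comment> \<open>A length in \<open>[0, B]\<close> has \<open>\<bar>n\<bar> \<le> B + 2\<close>,
    because \<open>r\<close> and \<open>s\<close> lie in \<open>[0, 1]\<close>. So only finitely
    many reduced lengths compete.\<close>
  define N where "N = \<lceil>B\<rceil> + 3"
  have "C \<inter> {..B} \<subseteq> (\<Union>n\<in>{-N..N}. {n + r + s, n + r - s, n - r + s, n - r - s})"
  proof
    fix M assume "M \<in> C \<inter> {..B}"
    then obtain n :: int where n: "M \<in> {n + r + s, n + r - s, n - r + s, n - r - s}"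
      and "M \<le> B" "0 \<le> M" unfolding C_def using path_props by blast
    then have "\<bar>real_of_int n\<bar> \<le> B + 2" using p(2) q(2) by auto
    then have "n \<in> {-N..N}" unfolding N_def by (auto; linarith)
    then show "M \<in> (\<Union>n\<in>{-N..N}. {n + r + s, n + r - s, n - r + s, n - r - s})" using n by blast
  qed
  then have fin: "finite (C \<inter> {..B})" by (rule finite_subset) auto
  define m where "m = Min (C \<inter> {..B})"
  have m: "m \<in> C \<inter> {..B}" unfolding m_def using fin B by (intro Min_in) auto
  have "m \<le> M" if w: "walk p q M" for M
  proof -
    obtain c where "c \<in> C" "c \<le> M" using red[OF w] unfolding C_def by blast
    then show ?thesis using m Min_le[OF fin, of c] unfolding m_def by (cases "c \<le> B") auto
  qed
  then have "d p q = m"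
    using dist_ge[OF assms(2,3)] dist_le[of p q m] m unfolding C_def by (intro antisym) auto
  then show ?thesis using m unfolding C_def by simp
qed

lemma unit_length_geodesic:
  assumes "\<And>u v. A u v \<Longrightarrow> l u v = 1" shows "geodesic_space points d"
  using geodesicI dist_attained assms by blast

end

section \<open>Chains of large projections\<close>

locale rooted_projections = graphs_with_projections I V A pr \<theta>
  for I :: "'i set" and V :: "'i \<Rightarrow> 'v set" and A :: "'i \<Rightarrow> 'v \<Rightarrow> 'v \<Rightarrow> bool"
    and pr :: "'i \<Rightarrow> 'i \<Rightarrow> 'v set" and \<theta> :: nat +
  fixes K :: nat and R :: 'i
  assumes K_pos: "K > 0" and K_ge: "K \<ge> 4 * \<theta>" and root: "R \<in> I"
begin

abbreviation D :: "'i \<Rightarrow> 'i \<Rightarrow> 'i \<Rightarrow> ereal" where "D \<equiv> proj_diam V A pr"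

lemma graph: "Y \<in> I \<Longrightarrow> metric_graph (V Y) (A Y) unit_length"
  by unfold_locales (auto simp: connected)

lemma D_sym: "D Y X Z = D Y Z X"
  unfolding proj_diam_def by (simp add: Un_commute)

lemma D_cong: "pr Y X = pr Y X' \<Longrightarrow> D Y X Z = D Y X' Z"
  unfolding proj_diam_def by simp

lemma D_cong2: "pr Y Z = pr Y Z' \<Longrightarrow> D Y X Z = D Y X Z'"
  unfolding proj_diam_def by simp

lemma D_le_dist:
  assumes "X \<in> I" "Y \<in> I" "Z \<in> I" "X \<noteq> Y" "Z \<noteq> Y" "D Y X Z \<le> ereal c"
    and "x \<in> pr Y X \<union> pr Y Z" "z \<in> pr Y X \<union> pr Y Z"
  shows "path_dist (V Y) (A Y) unit_length (vertex_pt x) (vertex_pt z) \<le> c"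
proof -
  interpret G: metric_graph "V Y" "A Y" unit_length by (rule graph[OF assms(2)])
  have "path_edist (V Y) (A Y) unit_length (vertex_pt x) (vertex_pt z) \<le> D Y X Z"
    unfolding proj_diam_def using assms by (intro SUP_upper2[of x] SUP_upper) auto
  also have "\<dots> \<le> ereal c" by fact
  finally have "path_edist (V Y) (A Y) unit_length (vertex_pt x) (vertex_pt z) \<le> ereal c" .
  moreover have "x \<in> V Y" "z \<in> V Y"
    using pr_subset[OF assms(1,2,4)] pr_subset[OF assms(3,2,5)] assms(7,8) by auto
  ultimately show ?thesis using G.edist_eq[OF G.vertex_pt_in G.vertex_pt_in] by simp
qed

lemma D_triangle:
  assumes "X \<in> I" "Y \<in> I" "Z \<in> I" "W \<in> I" "X \<noteq> Y" "Z \<noteq> Y" "W \<noteq> Y"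
    and a: "D Y X W \<le> ereal a" and b: "D Y W Z \<le> ereal b" and c: "a + b \<le> c"
  shows "D Y X Z \<le> ereal c"
  unfolding proj_diam_def
proof (intro SUP_least)
  interpret G: metric_graph "V Y" "A Y" unit_length by (rule graph[OF assms(2)])
  fix x z assume x: "x \<in> pr Y X \<union> pr Y Z" and z: "z \<in> pr Y X \<union> pr Y Z"
  obtain w where w: "w \<in> pr Y W" using pr_nonempty[OF assms(4,2,7)] by blast
  have in_V: "x \<in> V Y" "z \<in> V Y" "w \<in> V Y"
    using x z w pr_subset[OF assms(1,2,5)] pr_subset[OF assms(3,2,6)] pr_subset[OF assms(4,2,7)]
    by auto
  note da = D_le_dist[OF assms(1,2,4,5,7) a] and db = D_le_dist[OF assms(4,2,3,7,6) b]
  have tri: "G.d (vertex_pt x) (vertex_pt z) \<le> G.d (vertex_pt x) (vertex_pt w) + G.d (vertex_pt w) (vertex_pt z)"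
    using in_V by (intro G.triangle G.vertex_pt_in)
  have nonneg: "0 \<le> a" "0 \<le> b"
    using da[of w w] db[of w w] w order_trans[OF G.nonneg[of "vertex_pt w" "vertex_pt w"]] by blast+
  consider "x \<in> pr Y X" "z \<in> pr Y X" | "x \<in> pr Y X" "z \<in> pr Y Z" | "x \<in> pr Y Z" "z \<in> pr Y X"
    | "x \<in> pr Y Z" "z \<in> pr Y Z" using x z by blast
  then have "G.d (vertex_pt x) (vertex_pt z) \<le> a + b"
  proof cases
    case 1
    then show ?thesis using da[of x z] nonneg by simp
  next
    case 2
    then show ?thesis using da[of x w] db[of w z] w tri by simp
  next
    case 3
    then show ?thesis using db[of x w] da[of w z] w tri by simp
  next
    case 4
    then show ?thesis using db[of x z] nonneg by simp
  qed
  then show "path_edist (V Y) (A Y) unit_length (vertex_pt x) (vertex_pt z) \<le> ereal c"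
    using G.edist_eq[OF G.vertex_pt_in G.vertex_pt_in] in_V c by simp
qed

lemma proj_eq:
  "D Y X Z > ereal (real \<theta>) \<Longrightarrow> X \<in> I \<Longrightarrow> Y \<in> I \<Longrightarrow> Z \<in> I \<Longrightarrow> X \<noteq> Y \<Longrightarrow> Y \<noteq> Z \<Longrightarrow> X \<noteq> Z \<Longrightarrow>
    pr X Y = pr X Z"
  using P1' by blast

lemma less_K: "a > ereal (real K) \<Longrightarrow> a > ereal (real \<theta>)"
  using K_ge by (elim order.strict_trans1[rotated]) simp

lemma not_less_self: "X \<in> I \<Longrightarrow> Y \<in> I \<Longrightarrow> X \<noteq> Y \<Longrightarrow> \<not> D Y X X > ereal (real K)"
  using less_K diam_self by (meson leD)

section \<open>Pieces separating \<open>X\<close> from the root, and the parent of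
  \<open>X\<close>\<close>

definition chain :: "'i \<Rightarrow> 'i set" where
  "chain X = {W \<in> I - {R, X}. D W R X > ereal (real K)}"

lemma chainD:
  assumes "W \<in> chain X"
  shows "W \<in> I" "W \<noteq> R" "W \<noteq> X" "D W R X > ereal (real K)" "D W R X > ereal (real \<theta>)"
  using assms less_K unfolding chain_def by auto

lemma chain_root [simp]: "chain R = {}"
  using not_less_self[OF root] unfolding chain_def by auto

lemma finite_chain: "X \<in> I \<Longrightarrow> finite (chain X)"
  by (rule finite_subset[OF _ finite_large[OF root, of X]]) (auto simp: chain_def intro: less_K)

text \<open>(P1') applied at \<open>W\<close>, which separates \<open>R\<close> from
  \<open>X\<close>: each of these two sees \<open>W\<close> where it sees the other.\<close>

lemma chain_pr:
  assumes "W \<in> chain X" "X \<in> I"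
  shows "pr R W = pr R X" "pr X W = pr X R"
proof -
  note W = chainD[OF assms(1)]
  have "X \<noteq> R" using assms by auto
  then show "pr R W = pr R X" using proj_eq[OF W(5)] W assms root by auto
  show "pr X W = pr X R"
    using proj_eq[of W X R] W assms root \<open>X \<noteq> R\<close> D_sym[of W R X] by auto
qed

text \<open>From \<open>W'\<close>, the piece \<open>W\<close> looks like \<open>R\<close>, so
  \<open>D W' W X = D W' R X\<close> is large. This is impossible for \<open>W = X\<close>, and
  otherwise (P1') at \<open>W'\<close> shows that \<open>W\<close> sees \<open>W'\<close> and
  \<open>X\<close> alike.\<close>

lemma chain_pr_between:
  assumes "W \<in> chain W'" "W' \<in> chain X" "X \<in> I"
  shows "W \<noteq> X" "pr W W' = pr W X"
proof -
  note W = chainD[OF assms(1)] and W' = chainD[OF assms(2)]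
  have eq: "pr W' W = pr W' R" using chain_pr(2)[OF assms(1)] W' by blast
  show "W \<noteq> X"
  proof
    assume "W = X"
    then have "D W' R X = D W' R R" using D_cong2[OF eq] by simp
    then show False using W'(4) not_less_self[OF root, of W'] W' by auto
  qed
  then show "pr W W' = pr W X"
    using proj_eq[of W' W X] W W' D_cong[OF eq, of X] assms by auto
qed

lemma chain_trans:
  assumes "W \<in> chain W'" "W' \<in> chain X" "X \<in> I"
  shows "W \<in> chain X"
  using chain_pr_between[OF assms] chainD[OF assms(1)] D_cong2[of W W' X R] unfolding chain_def by auto

lemma chain_asym: "W \<in> chain W' \<Longrightarrow> W' \<in> I \<Longrightarrow> W \<in> I \<Longrightarrow> W' \<notin> chain W"
  using chain_trans chainD(3) by blast

text \<open>As \<open>D W R X\<close> exceeds \<open>2 * \<theta>\<close>, on \<open>W\<close> the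
  piece \<open>W'\<close> is more than \<theta> away from \<open>R\<close> or from \<open>X\<close>.
  In the first case two uses of (P1') make \<open>W'\<close> look like \<open>X\<close> from
  \<open>W\<close>, so \<open>W\<close> precedes \<open>W'\<close>; in the second \<open>W\<close>
  looks like \<open>X\<close> from \<open>W'\<close>, so \<open>W'\<close> precedes
  \<open>W\<close>.\<close>

lemma chain_total:
  assumes "W \<in> chain X" "W' \<in> chain X" "W \<noteq> W'" "X \<in> I"
  shows "W \<in> chain W' \<or> W' \<in> chain W"
proof -
  note W = chainD[OF assms(1)] and W' = chainD[OF assms(2)]
  have "D W R X \<le> ereal (real K)" if "D W R W' \<le> ereal (real \<theta>)" "D W W' X \<le> ereal (real \<theta>)"
    using W W' assms root K_ge by (intro D_triangle[OF _ _ _ _ _ _ _ that]) auto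
  then have "D W R W' > ereal (real \<theta>) \<or> D W W' X > ereal (real \<theta>)"
    using W(4) by (meson not_less)
  then show ?thesis
  proof
    assume "D W R W' > ereal (real \<theta>)"
    then have "pr W' W = pr W' R"
      using proj_eq[of W W' R] W W' root D_sym[of W R W'] assms(3) by auto
    then have "D W' W X > ereal (real \<theta>)" using D_cong[of W' W R X] W' by simp
    then have "pr W W' = pr W X" using proj_eq[of W' W X] W W' assms by auto
    then show ?thesis using W W' assms D_cong2[of W W' X R] unfolding chain_def by auto
  next
    assume "D W W' X > ereal (real \<theta>)"
    then have "pr W' W = pr W' X" using proj_eq[of W W' X] W W' assms by auto
    then show ?thesis using W W' assms D_cong2[of W' W X R] unfolding chain_def by auto
  qed
qed

definition par :: "'i \<Rightarrow> 'i" where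
  "par X = (if chain X = {} then R else SOME P. P \<in> chain X \<and> chain X \<subseteq> insert P (chain P))"

lemma par_last:
  assumes "X \<in> I" "chain X \<noteq> {}"
  shows "par X \<in> chain X \<and> chain X \<subseteq> insert (par X) (chain (par X))"
proof -
  \<comment> \<open>In a finite linear order the last element is the one with the most
    predecessors.\<close>
  define n where "n = Max ((\<lambda>P. card (chain P)) ` chain X)"
  have fin: "finite ((\<lambda>P. card (chain P)) ` chain X)" using finite_chain[OF assms(1)] by simp
  have "n \<in> (\<lambda>P. card (chain P)) ` chain X"
    unfolding n_def using fin assms(2) by (intro Max_in) auto
  then obtain P where P: "P \<in> chain X" "card (chain P) = n" by blast
  have "W \<in> chain P" if W: "W \<in> chain X" "W \<noteq> P" for W
  proof (rule ccontr)
    assume "W \<notin> chain P"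
    then have PW: "P \<in> chain W" using chain_total[OF P(1) W(1)] W assms by blast
    have "W \<in> I" using chainD[OF W(1)] by blast
    have "insert P (chain P) \<subseteq> chain W" using PW chain_trans[OF _ PW \<open>W \<in> I\<close>] by blast
    then have "card (insert P (chain P)) \<le> card (chain W)"
      using finite_chain \<open>W \<in> I\<close> by (intro card_mono) auto
    moreover have "P \<notin> chain P" using chainD(3) by blast
    ultimately have "n < card (chain W)"
      using finite_chain[of P] chainD[OF P(1)] P(2) by simp
    moreover have "card (chain W) \<le> n" unfolding n_def using fin W by (intro Max_ge) auto
    ultimately show False by simp
  qed
  then have "\<exists>P. P \<in> chain X \<and> chain X \<subseteq> insert P (chain P)" using P by blast
  from someI_ex[OF this] show ?thesis using assms(2) unfolding par_def by simp
qed

lemma par_in: "X \<in> I \<Longrightarrow> par X \<in> I"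
  using par_last[of X] chainD(1) root by (cases "chain X = {}") (auto simp: par_def)

text \<open>\<open>R\<close> is in no chain, so \<open>par X = R\<close> encodes an empty chain. In
  this recursive form \<open>chain X\<close> is the set of proper ancestors of \<open>X\<close>
  other than \<open>R\<close>.\<close>

lemma chain_eq:
  assumes "X \<in> I" shows "chain X = (if par X = R then {} else insert (par X) (chain (par X)))"
proof (cases "chain X = {}")
  case True
  then show ?thesis by (simp add: par_def)
next
  case False
  then have "par X \<in> chain X" "chain X \<subseteq> insert (par X) (chain (par X))" using par_last assms by auto
  then show ?thesis using chainD(2) chain_trans[OF _ _ assms] by auto
qed

lemma par_in_chain: "X \<in> I \<Longrightarrow> par X \<noteq> R \<Longrightarrow> par X \<in> chain X"
  using chain_eq[of X] by auto

lemma par_neq: "X \<in> I \<Longrightarrow> X \<noteq> R \<Longrightarrow> par X \<noteq> X"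
  using par_in_chain[of X] chainD(3)[of "par X" X] by auto

lemma par_pr: assumes "X \<in> I" shows "pr X (par X) = pr X R"
  using chain_pr(2)[OF par_in_chain[OF assms] assms] by (cases "par X = R") auto

lemma par_pr_between:
  assumes "X \<in> I" "Y = R \<or> Y \<in> chain X" "Y \<noteq> par X"
  shows "pr Y (par X) = pr Y X"
proof (cases "Y = R")
  case True
  then show ?thesis using chain_pr(1)[OF par_in_chain[OF assms(1)] assms(1)] assms(3) by auto
next
  case False
  then have "Y \<in> chain (par X)" "par X \<noteq> R" using assms chain_eq[OF assms(1)] by (auto split: if_splits)
  then show ?thesis using chain_pr_between(2) par_in_chain assms by blast
qed

text \<open>A piece \<open>W\<close> violating adjacency would belong to \<open>chain X\<close> and
  come after \<open>par X\<close>, contradicting the choice of the parent as the last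
  element.\<close>

lemma par_adj:
  assumes "X \<in> I" "X \<noteq> R"
  shows "PK_adj I V A pr K (par X) X"
  unfolding PK_adj_def
proof (intro conjI ballI)
  fix W assume W: "W \<in> I - {par X, X}"
  show "D W (par X) X \<le> ereal (real K)"
  proof (cases "par X = R")
    case True
    then have "W \<notin> chain X" using chain_eq[OF assms(1)] by auto
    then show ?thesis using True W unfolding chain_def by auto
  next
    case False
    define P where "P = par X"
    have P: "P \<in> chain X" using par_in_chain False assms P_def by blast
    note P' = chainD[OF P]
    show ?thesis
    proof (rule ccontr)
      assume "\<not> ?thesis"
      then have less: "D W P X > ereal (real K)" by (simp add: P_def)
      have "pr P W = pr P X" using proj_eq[OF less_K[OF less]] W P' assms P_def by auto
      then have DP: "D P R W > ereal (real K)" using D_cong2[of P W X R] P' by simp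
      then have "W \<noteq> R" using not_less_self[OF root] P' by auto
      then have PW: "P \<in> chain W" using P' W DP P_def unfolding chain_def by auto
      then have "pr W P = pr W R" using chain_pr(2) W by blast
      then have "W \<in> chain X" using W less D_cong[of W P R X] \<open>W \<noteq> R\<close> unfolding chain_def by auto
      then have "W \<in> chain P" using chain_eq[OF assms(1)] W False P_def by auto
      then show False using chain_asym[OF PW] W P' by auto
    qed
  qed
qed (use par_in par_neq assms in auto)

section \<open>Chains of two adjacent vertices of the projection complex\<close>

context
  fixes X Z assumes adj: "PK_adj I V A pr K X Z"
begin

lemma adjD: "X \<in> I" "Z \<in> I" "X \<noteq> Z"
  "\<And>Y. Y \<in> I \<Longrightarrow> Y \<noteq> X \<Longrightarrow> Y \<noteq> Z \<Longrightarrow> \<not> D Y X Z > ereal (real K)"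
  using adj unfolding PK_adj_def by (auto simp: not_less)

text \<open>A higher ancestor looks like \<open>R\<close> from \<open>par X\<close>, so
  \<open>par X\<close> would separate it from \<open>X\<close> by more than
  \<open>K\<close>.\<close>

lemma adj_ancestor:
  assumes "X \<noteq> R" "Z = R \<or> Z \<in> chain X" shows "Z = par X"
proof (rule ccontr)
  assume neq: "Z \<noteq> par X"
  have ZP: "par X \<noteq> R" "Z = R \<or> Z \<in> chain (par X)"
    using assms neq chain_eq[OF adjD(1)] by (auto split: if_splits)
  note P = par_in_chain[OF adjD(1) ZP(1)]
  have "pr (par X) Z = pr (par X) R" using ZP chain_pr(2) par_in adjD by blast
  then have "D (par X) X Z > ereal (real K)"
    using chainD(4)[OF P] D_cong2[of "par X" Z R X] D_sym[of "par X"] by simp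
  then show False using adjD(4)[of "par X"] chainD[OF P] neq by auto
qed

text \<open>If \<open>W\<close> in \<open>chain X\<close> is missing from \<open>chain Z\<close>,
  every later \<open>W'\<close> in \<open>chain X\<close> satisfies
  \<open>D W' R Z \<le> \<theta>\<close> (\<open>up\<close>), but only \<open>par X\<close> can
  satisfy this (\<open>low\<close>). So at most one element of \<open>chain X\<close> comes after
  \<open>W\<close>.\<close>

lemma adj_excess:
  assumes "X \<noteq> R" "Z \<noteq> R" "Z \<notin> chain X"
  shows "chain X - chain Z \<subseteq> {par X, par (par X)}"
proof -
  \<comment> \<open>For an earlier \<open>W\<close>, the bound forces
    \<open>D W Z X > \<theta>\<close>, and \<open>par X\<close> looks like \<open>X\<close> from
    \<open>W\<close>. Hence \<open>par X\<close> sees \<open>Z\<close> where it sees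
    \<open>W\<close>, that is, where it sees \<open>R\<close>, and it separates \<open>X\<close>
    from \<open>Z\<close> by more than \<open>K\<close>.\<close>
  have low: "W = par X" if W: "W \<in> chain X" and le: "D W R Z \<le> ereal (real \<theta>)" for W
  proof (rule ccontr)
    assume neq: "W \<noteq> par X"
    note W' = chainD[OF W]
    have WP: "W \<in> chain (par X)" "par X \<noteq> R"
      using W neq chain_eq[OF adjD(1)] by (auto split: if_splits)
    note P = par_in_chain[OF adjD(1) WP(2)]
    note P' = chainD[OF P]
    have nZ: "W \<noteq> Z" "par X \<noteq> Z" using W P assms by auto
    have "D W R X \<le> ereal (real K)" if "D W Z X \<le> ereal (real \<theta>)"
      using W' nZ adjD(1,2) root K_ge by (intro D_triangle[OF _ _ _ _ _ _ _ le that]) auto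
    then have "\<not> D W Z X \<le> ereal (real \<theta>)" using W'(4) by auto
    moreover have "pr W (par X) = pr W X" using chain_pr_between[OF WP(1) P adjD(1)] by simp
    ultimately have "D W (par X) Z > ereal (real \<theta>)" using D_cong[of W "par X" X Z] D_sym[of W] by auto
    from proj_eq[OF this] have "pr (par X) W = pr (par X) Z"
      using P'(1) W'(1) nZ adjD(2) neq by auto
    moreover have "pr (par X) W = pr (par X) R" using chain_pr(2)[OF WP(1) P'(1)] .
    ultimately have "D (par X) X Z > ereal (real K)"
      using P'(4) D_cong2[of "par X" Z R X] D_sym[of "par X"] by simp
    then show False using adjD(4)[of "par X"] P' nZ by auto
  qed
  \<comment> \<open>Otherwise \<open>W'\<close> also separates \<open>W\<close> from
    \<open>Z\<close> by more than \<theta>. Then \<open>W\<close> sees \<open>Z\<close>,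
    \<open>W'\<close> and \<open>X\<close> at the same projection and belongs to
    \<open>chain Z\<close> because it belongs to \<open>chain X\<close>.\<close>
  have up: "D W' R Z \<le> ereal (real \<theta>)"
    if W: "W \<in> chain W'" and W': "W' \<in> chain X" and nW: "W \<notin> chain Z" for W W'
  proof (rule ccontr)
    assume "\<not> ?thesis"
    moreover have "pr W' W = pr W' R" using chain_pr(2)[OF W] chainD[OF W'] by blast
    ultimately have less: "D W' W Z > ereal (real \<theta>)" using D_cong[of W' W R Z] by simp
    have WX: "W \<in> chain X" using chain_trans[OF W W' adjD(1)] .
    have nZ: "W \<noteq> Z" "W' \<noteq> Z" using WX W' assms by auto
    have "pr W W' = pr W Z" using proj_eq[OF less] chainD[OF W] chainD[OF W'] nZ adjD by blast
    moreover have "pr W W' = pr W X" using chain_pr_between[OF W W' adjD(1)] by simp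
    ultimately have "W \<in> chain Z"
      using D_cong2[of W Z X R] chainD[OF WX] nZ unfolding chain_def by auto
    then show False using nW by simp
  qed
  show ?thesis
  proof
    fix W assume W: "W \<in> chain X - chain Z"
    show "W \<in> {par X, par (par X)}"
    proof (rule ccontr)
      assume neq: "W \<notin> {par X, par (par X)}"
      define P where "P = par X"
      have WP: "W \<in> chain P" "P \<noteq> R" using W neq chain_eq[OF adjD(1)] P_def by (auto split: if_splits)
      have PX: "P \<in> chain X" using par_in_chain WP(2) adjD P_def by blast
      have PI: "P \<in> I" using chainD[OF PX] by blast
      have WPP: "W \<in> chain (par P)" "par P \<noteq> R"
        using WP neq chain_eq[OF PI] P_def by (auto split: if_splits)
      have PP: "par P \<in> chain P" using par_in_chain PI WPP by blast
      have PPX: "par P \<in> chain X" using chain_trans[OF PP PX adjD(1)] .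
      have "par P = P" using low[OF PPX up[OF WPP(1) PPX]] W P_def by blast
      then show False using PP chainD(3) by metis
    qed
  qed
qed

end

end

section \<open>The tree of graphs\<close>

lemma geodesic_space_image:
  assumes "geodesic_space M d" "Metric_space (f ` M) d'"
    and iso: "\<And>x y. x \<in> M \<Longrightarrow> y \<in> M \<Longrightarrow> d' (f x) (f y) = d x y"
  shows "geodesic_space (f ` M) d'"
  unfolding geodesic_space_def
proof (intro conjI assms(2) ballI)
  fix x' y' assume "x' \<in> f ` M" "y' \<in> f ` M"
  then obtain x y where xy: "x \<in> M" "y \<in> M" "x' = f x" "y' = f y" by blast
  then obtain g where g: "g \<in> {0..d x y} \<rightarrow> M" "g 0 = x" "g (d x y) = y"
    "\<forall>s\<in>{0..d x y}. \<forall>t\<in>{0..d x y}. d (g s) (g t) = \<bar>s - t\<bar>"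
    using assms(1) unfolding geodesic_space_def by metis
  have "d' (f (g s)) (f (g t)) = \<bar>s - t\<bar>" if "s \<in> {0..d x y}" "t \<in> {0..d x y}" for s t
    using iso[of "g s" "g t"] g(1,4) that by (auto simp: Pi_iff)
  then show "\<exists>g. g \<in> {0..d' x' y'} \<rightarrow> f ` M \<and> g 0 = x' \<and> g (d' x' y') = y' \<and>
      (\<forall>s\<in>{0..d' x' y'}. \<forall>t\<in>{0..d' x' y'}. d' (g s) (g t) = \<bar>s - t\<bar>)"
    using g(1-3) iso[OF xy(1,2)] xy by (intro exI[of _ "f \<circ> g"]) auto
qed

lemma IVT_between:
  fixes \<phi> :: "real \<Rightarrow> real"
  assumes "continuous_on {a..b} \<phi>" "a \<le> b" "min (\<phi> a) (\<phi> b) \<le> s" "s \<le> max (\<phi> a) (\<phi> b)"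
  obtains u where "u \<in> {a..b}" "\<phi> u = s"
  using IVT'[of \<phi> a s b] IVT2'[of \<phi> b s a] assms by (cases "\<phi> a \<le> \<phi> b") (auto simp: min_def max_def)

text \<open>Two nearby values are joined by both arcs of the loop, so every value in between is attained
  twice.\<close>

lemma loop_avoids_injective_values:
  fixes \<phi> :: "real \<Rightarrow> real"
  assumes cont: "continuous_on {0..1} \<phi>" and loop: "\<phi> 0 = \<phi> 1"
    and inj: "\<And>s t. s \<in> {0..<1} \<Longrightarrow> t \<in> {0..<1} \<Longrightarrow> \<phi> s = \<phi> t \<Longrightarrow> 0 < \<phi> s \<Longrightarrow> \<phi> s < 1 \<Longrightarrow> s = t"
    and t: "t \<in> {0..1}"
  shows "\<not> (0 < \<phi> t \<and> \<phi> t < 1)"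
proof
  assume "0 < \<phi> t \<and> \<phi> t < 1"
  then obtain a where a: "a \<in> {0..<1}" "0 < \<phi> a" "\<phi> a < 1"
    using t loop by (cases "t = 1") (fastforce, force)
  \<comment> \<open>The radius keeps nearby values inside the open interval \<open>(0, 1)\<close>,
    where injectivity is available.\<close>
  obtain e where e: "0 < e" "\<And>b. b \<in> {0..1} \<Longrightarrow> dist b a < e \<Longrightarrow> dist (\<phi> b) (\<phi> a) < min (\<phi> a) (1 - \<phi> a)"
    using cont a unfolding continuous_on_iff
    by (metis atLeastLessThan_iff atLeastAtMost_iff diff_gt_0_iff_gt less_eq_real_def min_less_iff_conj)
  obtain m where m: "0 < m" "m \<le> e" "m \<le> 1 - a"
    using that[of "min e (1 - a)"] a e(1) by auto
  define b where "b = a + m / 2"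
  have b: "a < b" "b < 1" "dist b a < e" using m unfolding b_def dist_real_def by linarith+
  then have \<phi>b: "0 < \<phi> b" "\<phi> b < 1" using e(2)[of b] a unfolding dist_real_def by auto
  have ne: "\<phi> a \<noteq> \<phi> b" using inj[of a b] a b by auto
  define s where "s = (\<phi> a + \<phi> b) / 2"
  have s: "0 < s" "s < 1" "s \<noteq> \<phi> a" "s \<noteq> \<phi> b" "min (\<phi> a) (\<phi> b) < s" "s < max (\<phi> a) (\<phi> b)"
    using a \<phi>b ne unfolding s_def by (auto simp: min_def max_def)
  have c: "continuous_on {a..b} \<phi>" "continuous_on {0..a} \<phi>" "continuous_on {b..1} \<phi>"
    using a b by (auto intro: continuous_on_subset[OF cont])
  obtain u where u: "u \<in> {a..b}" "\<phi> u = s" 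
    using IVT_between[OF c(1) less_imp_le[OF b(1)] less_imp_le[OF s(5)] less_imp_le[OF s(6)]] .
  \<comment> \<open>The complementary arc goes from \<open>b\<close> to 1 and, as
    \<open>\<phi> 0 = \<phi> 1\<close>, on from 0 to \<open>a\<close>. If \<open>s\<close> is not
    between the end values on one part, it is on the other.\<close>
  have "\<exists>v. v \<in> {0..a} \<union> {b..1} \<and> \<phi> v = s"
  proof (cases "min (\<phi> 0) (\<phi> a) \<le> s \<and> s \<le> max (\<phi> 0) (\<phi> a)")
    case True
    then obtain v where "v \<in> {0..a}" "\<phi> v = s" using IVT_between[OF c(2), of s] a(1) by auto
    then show ?thesis by blast
  next
    case False
    then have "min (\<phi> b) (\<phi> 1) \<le> s" "s \<le> max (\<phi> b) (\<phi> 1)" using s(5,6) loop by (auto simp: min_def max_def split: if_splits)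
    then obtain v where "v \<in> {b..1}" "\<phi> v = s" using IVT_between[OF c(3), of s] b(2) by auto
    then show ?thesis by blast
  qed
  then obtain v where v: "v \<in> {0..a} \<union> {b..1}" "\<phi> v = s" by blast
  \<comment> \<open>Injectivity excludes the parameter 1, so 0 replaces it; \<open>a\<close> and
    \<open>b\<close> are excluded because \<open>s\<close> differs from their values.\<close>
  have "\<exists>v. v \<in> {0..<a} \<union> {b<..<1} \<and> \<phi> v = s"
  proof (cases "v = 1")
    case True
    then show ?thesis using v s loop a by (intro exI[of _ 0]) (auto simp: less_le)
  next
    case False
    then show ?thesis using v s by (intro exI[of _ v]) (auto simp: less_le)
  qed
  then obtain v where v: "v \<in> {0..<a} \<union> {b<..<1}" "\<phi> v = s" by blast
  then show False using inj[of u v] u s a b by auto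
qed

context rooted_projections
begin

lemma tree_induct [consumes 1, case_names base child]:
  assumes "X \<in> I" "Q R" and "\<And>X. X \<in> I \<Longrightarrow> X \<noteq> R \<Longrightarrow> Q (par X) \<Longrightarrow> Q X"
  shows "Q X"
  using assms(1)
proof (induction "card (chain X)" arbitrary: X rule: less_induct)
  case less
  show ?case
  proof (cases "X = R \<or> par X = R")
    case True
    then show ?thesis using assms(2) assms(3)[OF less(2)] by (cases "X = R") auto
  next
    case False
    then have "card (chain (par X)) < card (chain X)"
      using chain_eq[OF less(2)] chainD(3) finite_chain[OF par_in[OF less(2)]]
      by (metis card_insert_disjoint lessI)
    then show ?thesis using less assms(3) par_in False by blast
  qed
qed

section \<open>The subgraph \<open>T\<close> and its position in \<open>\<C>\<^sub>K\<close>\<close>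

definition pt :: "'i \<Rightarrow> 'i \<Rightarrow> 'v" where
  "pt X Z = (SOME p. p \<in> pr X Z)"

lemma pt_in: assumes "X \<in> I" "Z \<in> I" "X \<noteq> Z" shows "pt X Z \<in> pr X Z" "pt X Z \<in> V X"
proof -
  show "pt X Z \<in> pr X Z" using pr_nonempty[of Z X] assms unfolding pt_def by (auto intro: someI_ex)
  then show "pt X Z \<in> V X" using pr_subset[of Z X] assms by auto
qed

definition bridge :: "'i \<times> 'v \<Rightarrow> 'i \<times> 'v \<Rightarrow> bool" where
  "bridge a b \<longleftrightarrow> (\<exists>X\<in>I - {R}. a = (X, pt X (par X)) \<and> b = (par X, pt (par X) X))"

definition T_adj :: "'i \<times> 'v \<Rightarrow> 'i \<times> 'v \<Rightarrow> bool" where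
  "T_adj a b \<longleftrightarrow> fst a \<in> I \<and> fst a = fst b \<and> A (fst a) (snd a) (snd b) \<or> bridge a b \<or> bridge b a"

lemma bridge_adj: "X \<in> I \<Longrightarrow> X \<noteq> R \<Longrightarrow> T_adj (X, pt X (par X)) (par X, pt (par X) X)"
  unfolding T_adj_def bridge_def by blast

lemma simple_T: "simple_graph (Sigma I V) T_adj"
  unfolding simple_graph_def
proof (intro allI impI)
  have br: "a \<in> Sigma I V \<and> b \<in> Sigma I V \<and> a \<noteq> b" if "bridge a b" for a b
  proof -
    obtain X where X: "X \<in> I" "X \<noteq> R" "a = (X, pt X (par X))" "b = (par X, pt (par X) X)"
      using \<open>bridge a b\<close> unfolding bridge_def by blast
    then show ?thesis using pt_in(2) par_in[OF X(1)] par_neq[OF X(1,2)] by auto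
  qed
  fix a b assume "T_adj a b"
  then consider "fst a \<in> I" "fst a = fst b" "A (fst a) (snd a) (snd b)" | "bridge a b" | "bridge b a"
    unfolding T_adj_def by blast
  then show "a \<in> Sigma I V \<and> b \<in> Sigma I V \<and> a \<noteq> b \<and> T_adj b a"
  proof cases
    case 1
    then show ?thesis using metric_graph.adjD[OF graph[OF 1(1)] 1(3)]
      by (cases a; cases b) (auto simp: T_adj_def)
  next
    case 2
    then show ?thesis using br[OF 2] unfolding T_adj_def by blast
  next
    case 3
    then show ?thesis using br[OF 3] unfolding T_adj_def by blast
  qed
qed

lemma piece_connected:
  assumes "X \<in> I" "x \<in> V X" "y \<in> V X" shows "T_adj\<^sup>*\<^sup>* (X, x) (X, y)"
proof -
  have "(A X)\<^sup>*\<^sup>* x y" using connected[OF assms(1)] assms unfolding connected_graph_def by blast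
  then show ?thesis
  proof induction
    case (step y z)
    have "T_adj (X, y) (X, z)" using step assms(1) unfolding T_adj_def by simp
    then show ?case using step by simp
  qed simp
qed

lemma root_connected:
  assumes "X \<in> I" "x \<in> V X" "r \<in> V R" shows "T_adj\<^sup>*\<^sup>* (X, x) (R, r)"
  using assms(1,2)
proof (induction X arbitrary: x rule: tree_induct)
  case base
  then show ?case using piece_connected root assms by blast
next
  case (child X)
  have "T_adj\<^sup>*\<^sup>* (X, x) (X, pt X (par X))"
    using child pt_in(2) par_in par_neq piece_connected by metis
  moreover have "T_adj\<^sup>*\<^sup>* (par X, pt (par X) X) (R, r)"
    using child pt_in(2) par_in par_neq by metis
  ultimately show ?case using bridge_adj[OF child(1,2)] by (meson rtranclp.rtrancl_into_rtrancl rtranclp_trans)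
qed

lemma connected_T: "connected_graph (Sigma I V) T_adj"
  unfolding connected_graph_def
proof (intro conjI simple_T ballI)
  fix a b assume ab: "a \<in> Sigma I V" "b \<in> Sigma I V"
  obtain r where r: "r \<in> V R"
  proof (cases "fst a = R")
    case False
    then show ?thesis using that pt_in(2)[of R "fst a"] ab root by auto
  qed (use that ab in auto)
  have "symp T_adj" using simple_T unfolding simple_graph_def by (auto intro: sympI)
  then have "T_adj\<^sup>*\<^sup>* (R, r) b"
    using root_connected[of "fst b" "snd b" r] ab r by (auto dest: sympD[OF symp_rtranclp])
  then show "T_adj\<^sup>*\<^sup>* a b" using root_connected[of "fst a" "snd a" r] ab r by auto
qed

text \<open>Bridges get length 1 instead of \<open>K\<close>: this changes distances by a bounded
  factor only and makes \<open>T\<close> geodesic.\<close>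

sublocale T: metric_graph "Sigma I V" T_adj unit_length
  by unfold_locales (auto simp: connected_T)

abbreviation "C_adj \<equiv> CK_adj I V A pr K"

lemma T_C_adj: assumes "T_adj a b" shows "C_adj a b"
proof -
  have PK_sym: "PK_adj I V A pr K X Z \<Longrightarrow> PK_adj I V A pr K Z X" for X Z
    using D_sym unfolding PK_adj_def by (metis insert_commute)
  have "C_adj a b \<and> C_adj b a" if "bridge a b" for a b
  proof -
    obtain X where X: "X \<in> I" "X \<noteq> R" "a = (X, pt X (par X))" "b = (par X, pt (par X) X)"
      using \<open>bridge a b\<close> unfolding bridge_def by blast
    have "pt X (par X) \<in> pr X (par X)" "pt (par X) X \<in> pr (par X) X"
      using pt_in(1) par_in[OF X(1)] par_neq[OF X(1,2)] X(1) by metis+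
    then show ?thesis using X par_adj[OF X(1,2)] PK_sym unfolding CK_adj_def by auto
  qed
  then show ?thesis using assms unfolding T_adj_def
    by (cases a; cases b) (auto simp: CK_adj_def)
qed

sublocale C: metric_graph "Sigma I V" C_adj "CK_length K"
proof
  have "simple_graph (Sigma I V) C_adj"
    unfolding simple_graph_def
  proof (intro allI impI)
    fix a b assume "C_adj a b"
    moreover obtain X x Y y where ab: "a = (X, x)" "b = (Y, y)" by (cases a; cases b) blast
    ultimately consider "X \<in> I" "X = Y" "A X x y" | "PK_adj I V A pr K X Y" "x \<in> pr X Y" "y \<in> pr Y X"
      unfolding CK_adj_def by auto
    then show "a \<in> Sigma I V \<and> b \<in> Sigma I V \<and> a \<noteq> b \<and> C_adj b a"
    proof cases
      case 1
      then show ?thesis using ab metric_graph.adjD[OF graph[OF 1(1)] 1(3)] unfolding CK_adj_def by auto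
    next
      case 2
      then have XY: "X \<in> I" "Y \<in> I" "X \<noteq> Y" unfolding PK_adj_def by auto
      have "PK_adj I V A pr K Y X" using 2(1) D_sym unfolding PK_adj_def by (metis insert_commute)
      then show ?thesis using 2 ab XY pr_subset[of X Y] pr_subset[of Y X] unfolding CK_adj_def by auto
    qed
  qed
  moreover have "T_adj\<^sup>*\<^sup>* a b \<Longrightarrow> C_adj\<^sup>*\<^sup>* a b" for a b
    by (rule rtranclp_mono[THEN predicate2D, rotated]) (auto simp: T_C_adj)
  ultimately show "connected_graph (Sigma I V) C_adj"
    using connected_T unfolding connected_graph_def by blast
  show "1 \<le> CK_length K a b" for a b
    using K_pos unfolding CK_length_def by (auto split: prod.splits)
qed

text \<open>The retraction to \<open>X\<close> collapses every other piece to a single vertex.  Below \<open>X\<close> the projection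
  of a piece to \<open>X\<close> agrees with that of its parent, so bridges are collapsed as well.\<close>

definition retr :: "'i \<Rightarrow> 'i \<times> 'v \<Rightarrow> 'v" where
  "retr X = (\<lambda>(Z, z). if Z = X then z else if X = R \<or> X \<in> chain Z then pt X Z else pt X R)"

lemma retr_in: "X \<in> I \<Longrightarrow> a \<in> Sigma I V \<Longrightarrow> retr X a \<in> V X"
  using pt_in(2) root unfolding retr_def by auto

lemma pt_cong: "pr X Z = pr X Z' \<Longrightarrow> pt X Z = pt X Z'"
  unfolding pt_def by simp

lemma retr_bridge:
  assumes "X \<in> I" "bridge a b" shows "retr X a = retr X b"
proof -
  obtain Z where Z: "Z \<in> I" "Z \<noteq> R" "a = (Z, pt Z (par Z))" "b = (par Z, pt (par Z) Z)"
    using assms(2) unfolding bridge_def by blast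
  note ne = par_neq[OF Z(1,2)]
  have eq: "X \<in> chain Z \<longleftrightarrow> par Z \<noteq> R \<and> (X = par Z \<or> X \<in> chain (par Z))"
    using chain_eq[OF Z(1)] by auto
  \<comment> \<open>The bridge leads up from \<open>X\<close>, arrives at \<open>X\<close> from a
    child, or avoids \<open>X\<close>.\<close>
  consider "X = Z" | "X = par Z" | "X \<noteq> Z" "X \<noteq> par Z" by blast
  then show ?thesis
  proof cases
    case 1
    then have "X \<notin> chain (par Z)"
      using eq chainD(3)[of Z Z] by (cases "par Z = R") auto
    then show ?thesis using 1 Z ne pt_cong[OF par_pr[OF Z(1)]] by (simp add: retr_def)
  next
    case 2
    then show ?thesis using Z ne eq by (auto simp: retr_def)
  next
    case 3
    then show ?thesis using Z eq pt_cong[OF par_pr_between[OF Z(1), of X]]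
      by (auto simp: retr_def)
  qed
qed

lemma retr_simplicial:
  assumes "X \<in> I" "T_adj a b" shows "retr X a = retr X b \<or> A X (retr X a) (retr X b)"
  using assms retr_bridge[OF assms(1), of a b] retr_bridge[OF assms(1), of b a]
  unfolding T_adj_def by (cases a; cases b) (auto simp: retr_def)

section \<open>Pieces as isometrically embedded retracts\<close>

abbreviation "Y_space X \<equiv> realization (V X) (A X)"
abbreviation "Y_dist X \<equiv> path_dist (V X) (A X) unit_length"

definition piece :: "'i \<Rightarrow> ('i \<times> 'v \<Rightarrow> real) set" where
  "piece X = push (Pair X) ` Y_space X"

lemma push_Pair_in: "X \<in> I \<Longrightarrow> p \<in> Y_space X \<Longrightarrow> push (Pair X) p \<in> T.points"
  by (rule push_in[OF graph T.metric_graph_axioms, of X 1]) (auto simp: T_adj_def)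

lemma push_retr_Pair:
  assumes "X \<in> I" "p \<in> Y_space X" shows "push (retr X) (push (Pair X) p) = p"
proof -
  interpret G: metric_graph "V X" "A X" unit_length by (rule graph[OF assms(1)])
  from assms(2) show ?thesis
  proof (cases p rule: G.points_cases)
    case (2 u v t)
    then show ?thesis using G.adjD(3)[OF 2(1)] by (simp add: push_edge_pt retr_def)
  qed (simp add: retr_def)
qed

text \<open>The inclusion \<open>Pair X\<close> and its left inverse \<open>retr X\<close> are both
  simplicial, hence both 1-Lipschitz.\<close>

lemma piece_isometry:
  assumes X: "X \<in> I" and "p \<in> Y_space X" "q \<in> Y_space X"
  shows "T.d (push (Pair X) p) (push (Pair X) q) = Y_dist X p q"
proof (rule antisym)
  show "T.d (push (Pair X) p) (push (Pair X) q) \<le> Y_dist X p q"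
    using push_dist[OF graph[OF X] T.metric_graph_axioms, of 1 "Pair X" p q] assms
    by (auto simp: T_adj_def)
  show "Y_dist X p q \<le> T.d (push (Pair X) p) (push (Pair X) q)"
    using push_dist[OF T.metric_graph_axioms graph[OF X], of 1 "retr X" "push (Pair X) p" "push (Pair X) q"]
      assms push_Pair_in push_retr_Pair retr_in retr_simplicial by auto
qed

lemma piece_subset: "X \<in> I \<Longrightarrow> piece X \<subseteq> T.points"
  unfolding piece_def using push_Pair_in by auto

lemma piece_metric: "X \<in> I \<Longrightarrow> Metric_space (piece X) T.d"
  using T.subspace[OF piece_subset] by (simp add: Submetric.axioms)

lemma piece_geodesic: "X \<in> I \<Longrightarrow> geodesic_space (piece X) T.d"
  using geodesic_space_image[OF metric_graph.unit_length_geodesic[OF graph], of X "push (Pair X)" T.d]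
    piece_metric piece_isometry unfolding piece_def by auto

lemma piece_quasi_isometric:
  assumes "X \<in> I" "1 \<le> c" shows "quasi_isometric c c (piece X) T.d (Y_space X) (Y_dist X)"
  unfolding quasi_isometric_def
proof (intro conjI exI[of _ "push (retr X)"] ballI)
  show "Metric_space (piece X) T.d" "Metric_space (Y_space X) (Y_dist X)"
    using piece_metric assms metric_graph.Metric[OF graph] by blast+
  interpret G: metric_graph "V X" "A X" unit_length by (rule graph[OF assms(1)])
  show "push (retr X) \<in> piece X \<rightarrow> Y_space X"
    unfolding piece_def using push_retr_Pair assms by auto
  show "\<exists>x\<in>piece X. Y_dist X z (push (retr X) x) \<le> c" if "z \<in> Y_space X" for z
    using that assms push_retr_Pair unfolding piece_def by force
  fix p q assume "p \<in> piece X" "q \<in> piece X"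
  then have eq: "Y_dist X (push (retr X) p) (push (retr X) q) = T.d p q"
    using piece_isometry push_retr_Pair assms(1) unfolding piece_def by auto
  have "T.d p q \<le> c * T.d p q" using mult_right_mono[OF assms(2) T.nonneg[of p q]] by simp
  moreover from this have "T.d p q / c \<le> T.d p q" using assms(2) by (simp add: divide_le_eq mult.commute)
  ultimately have "T.d p q / c \<le> T.d p q" "T.d p q \<le> c * T.d p q" by auto
  then show "T.d p q / c - c \<le> Y_dist X (push (retr X) p) (push (retr X) q)"
    "Y_dist X (push (retr X) p) (push (retr X) q) \<le> c * T.d p q + c"
    unfolding eq using assms(2) by linarith+
qed (use assms in auto)

text \<open>Indicator of the subtree hanging at \<open>Y\<close>, real-valued so that it can be
  interpolated. This reading requires \<open>Y \<noteq> R\<close>, as \<open>R\<close> is in no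
  chain.\<close>

definition side :: "'i \<Rightarrow> 'i \<Rightarrow> real" where
  "side Y Z = of_bool (Z = Y \<or> Y \<in> chain Z)"

lemma side_cases: "side Y Z = 0 \<or> side Y Z = 1"
  by (simp add: side_def)

text \<open>In barycentric coordinates, the mass of a point on the descendants of \<open>Y\<close> is a continuous
  function to \<open>[0, 1]\<close>, which is injective over \<open>(0, 1)\<close>: these values are attained only on the
  bridge from \<open>Y\<close> to its parent.\<close>

definition mass :: "'i \<Rightarrow> ('i \<times> 'v \<Rightarrow> real) \<Rightarrow> real" where
  "mass Y = interp (\<lambda>w. side Y (fst w))"

lemma mass_piece:
  assumes "Z \<in> I" "p \<in> piece Z" shows "mass Y p = side Y Z"
proof -
  interpret G: metric_graph "V Z" "A Z" unit_length by (rule graph[OF assms(1)])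
  obtain p' where p': "p' \<in> Y_space Z" "p = push (Pair Z) p'" using assms(2) unfolding piece_def by blast
  from p'(1) show ?thesis
  proof (cases p' rule: G.points_cases)
    case (2 u v t)
    then show ?thesis using p'(2) G.adjD(3)[OF 2(1)]
      by (simp add: push_edge_pt interp_edge_pt mass_def algebra_simps)
  qed (simp add: p' mass_def)
qed

lemma T_cases:
  assumes "p \<in> T.points"
  obtains Z where "Z \<in> I" "p \<in> piece Z"
  | X t where "X \<in> I" "X \<noteq> R" "0 < t" "t < 1" "p = edge_pt (X, pt X (par X)) (par X, pt (par X) X) t"
  using assms
proof (cases p rule: T.points_cases)
  case (1 u)
  then have "p \<in> piece (fst u)" unfolding piece_def realization_def
    using push_vertex_pt[of "Pair (fst u)" "snd u"] by force
  then show ?thesis using that 1 by auto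
next
  case (2 a b t)
  have vert: thesis if "p = vertex_pt u" "u \<in> Sigma I V" for u
  proof -
    have "p \<in> piece (fst u)" unfolding piece_def realization_def
      using push_vertex_pt[of "Pair (fst u)" "snd u"] that by force
    then show thesis using \<open>\<And>Z. Z \<in> I \<Longrightarrow> p \<in> piece Z \<Longrightarrow> thesis\<close> that by auto
  qed
  note ab = T.adjD[OF 2(1)]
  have "fst a \<in> I \<and> fst a = fst b \<and> A (fst a) (snd a) (snd b) \<or> bridge a b \<or> bridge b a"
    using 2(1) unfolding T_adj_def .
  then consider "fst a \<in> I" "fst a = fst b" "A (fst a) (snd a) (snd b)" | "t = 0 \<or> t = 1"
    | a' b' t' where "bridge a' b'" "0 < t'" "t' < 1" "p = edge_pt a' b' t'"
  proof (elim disjE conjE)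
    assume br: "bridge a b"
    show thesis
    proof (cases "t = 0 \<or> t = 1")
      case False
      then show ?thesis using \<open>\<And>a' b' t'. \<lbrakk>bridge a' b'; 0 < t'; t' < 1; p = edge_pt a' b' t'\<rbrakk> \<Longrightarrow> thesis\<close>[OF br, of t] 2 by auto
    qed (use that(2) in blast)
  next
    assume br: "bridge b a"
    show thesis
    proof (cases "t = 0 \<or> t = 1")
      case False
      then show ?thesis using \<open>\<And>a' b' t'. \<lbrakk>bridge a' b'; 0 < t'; t' < 1; p = edge_pt a' b' t'\<rbrakk> \<Longrightarrow> thesis\<close>[OF br, of "1 - t"] 2
          edge_pt_swap[OF ab(3), of t] by auto
    qed (use that(2) in blast)
  qed (use that(1) in blast)
  then show thesis
  proof cases
    case 1
    have "edge_pt (snd a) (snd b) t \<in> Y_space (fst a)"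
      using metric_graph.edge_pt_in[OF graph] 1 2 by blast
    moreover have "p = push (Pair (fst a)) (edge_pt (snd a) (snd b) t)"
      using 2 1 metric_graph.adjD(3)[OF graph] by (cases a; cases b) (auto simp: push_edge_pt)
    ultimately show ?thesis using that(1)[OF 1(1)] unfolding piece_def by blast
  next
    case _: 2
    then show ?thesis
    proof
      assume "t = 0"
      then show ?thesis using 2(3) vert[OF _ ab(1)] by simp
    next
      assume "t = 1"
      then show ?thesis using 2(3) vert[OF _ ab(2)] ab(3) by simp
    qed
  next
    case (3 a' b' t')
    then show ?thesis using that(2) unfolding bridge_def by blast
  qed
qed

lemma side_par: "X \<in> I \<Longrightarrow> X \<noteq> R \<Longrightarrow> Y \<noteq> X \<Longrightarrow> Y \<noteq> R \<Longrightarrow> side Y (par X) = side Y X"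
  using chain_eq[of X] unfolding side_def by auto

lemma mass_bridge:
  assumes "X \<in> I" "X \<noteq> R" "Y \<noteq> R"
  shows "mass Y (edge_pt (X, pt X (par X)) (par X, pt (par X) X) t) = (if Y = X then 1 - t else side Y X)"
proof -
  have "side X (par X) = 0" using par_neq[OF assms(1,2)] chain_eq[OF assms(1)] chainD(3)[of X X]
    by (auto simp: side_def split: if_splits)
  moreover have "side X X = 1" by (simp add: side_def)
  ultimately show ?thesis
    using par_neq[OF assms(1,2)] side_par[OF assms(1,2) _ assms(3)]
    by (auto simp: mass_def interp_edge_pt algebra_simps)
qed

lemma mass_interior:
  assumes "p \<in> T.points" "Y \<noteq> R" "0 < mass Y p" "mass Y p < 1"
  shows "p = edge_pt (Y, pt Y (par Y)) (par Y, pt (par Y) Y) (1 - mass Y p)"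
  using assms(1)
proof (cases p rule: T_cases)
  case (1 Z)
  then show ?thesis using mass_piece[of Z p Y] assms by (auto simp: side_def)
next
  case (2 X t)
  then have "mass Y p = (if Y = X then 1 - t else side Y X)" using mass_bridge[of X Y t] assms by blast
  then show ?thesis using 2 assms by (auto simp: side_def split: if_splits)
qed

lemma in_piece:
  assumes "p \<in> T.points" "\<And>Y. Y \<in> I \<Longrightarrow> Y \<noteq> R \<Longrightarrow> \<not> (0 < mass Y p \<and> mass Y p < 1)"
  obtains Z where "Z \<in> I" "p \<in> piece Z"
  using assms(1)
proof (cases p rule: T_cases)
  case (2 X t)
  then show ?thesis using assms(2)[of X] mass_bridge[of X X t] by auto
qed

text \<open>Two pieces cannot be above each other, so one of them, different from \<open>R\<close>,
  is not an ancestor of the other and serves as \<open>Y\<close>.\<close>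

lemma sides_separate:
  assumes "Z \<in> I" "Z' \<in> I" "Z \<noteq> Z'" obtains Y where "Y \<in> I" "Y \<noteq> R" "side Y Z \<noteq> side Y Z'"
proof -
  have "Z' \<in> chain Z \<Longrightarrow> Z \<notin> chain Z'" using chain_asym assms by blast
  then have "Z \<noteq> R \<and> side Z Z \<noteq> side Z Z' \<or> Z' \<noteq> R \<and> side Z' Z \<noteq> side Z' Z'"
    using assms by (auto simp: side_def)
  then show ?thesis using that assms by blast
qed

lemma mass_continuous:
  assumes "continuous_map (top_of_set S) T.mtopology g"
  shows "continuous_on S (mass Y \<circ> g)"
proof -
  have "continuous_map T.mtopology euclidean (mass Y)"
    unfolding mtopology_is_euclidean[symmetric] Met_TC.continuous_map_to_metric
  proof (intro ballI allI impI)
    fix p e assume p: "p \<in> topspace T.mtopology" and e: "0 < (e::real)"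
    have "mass Y q \<in> Met_TC.mball (mass Y p) e" if "q \<in> T.mball p e" for q
    proof -
      have "\<bar>mass Y p - mass Y q\<bar> \<le> T.d p q"
        unfolding mass_def using that by (intro T.interp_lipschitz) (auto simp: side_def)
      then show ?thesis using that by (simp add: dist_real_def)
    qed
    then show "\<exists>U. openin T.mtopology U \<and> p \<in> U \<and> (\<forall>q\<in>U. mass Y q \<in> Met_TC.mball (mass Y p) e)"
      using p e by (intro exI[of _ "T.mball p e"]) auto
  qed
  from continuous_map_compose[OF assms this] show ?thesis by simp
qed

text \<open>Each \<open>mass Y\<close> is injective over \<open>(0, 1)\<close> along the loop, hence
  never takes a value there. So the loop avoids the interior of every bridge.\<close>

lemma simple_loop_in_piece:
  assumes "simple_loop_in T.mtopology g" obtains Z where "Z \<in> I" "g ` {0..1} \<subseteq> piece Z"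
proof -
  have g: "continuous_map (top_of_set {0..1}) T.mtopology g" "g 0 = g 1" "inj_on g {0..<1}"
    using assms unfolding simple_loop_in_def pathin_def by auto
  have gX: "g t \<in> T.points" if "t \<in> {0..1}" for t
    using continuous_map_image_subset_topspace[OF g(1)] that by auto
  have cont: "continuous_on {0..1} (mass Y \<circ> g)" for Y by (rule mass_continuous[OF g(1)])
  have nint: "\<not> (0 < mass Y (g t) \<and> mass Y (g t) < 1)" if Y: "Y \<noteq> R" and t: "t \<in> {0..1}" for Y t
  proof -
    have "s = t" if st: "s \<in> {0..<1}" "t \<in> {0..<1}" "mass Y (g s) = mass Y (g t)"
      "0 < mass Y (g s)" "mass Y (g s) < 1" for s t
    proof -
      have "g s \<in> T.points" "g t \<in> T.points" using gX st by auto
      then have "g s = g t" using mass_interior[of "g s" Y] mass_interior[of "g t" Y] st Y by simp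
      then show ?thesis using g(3) st by (simp add: inj_on_def)
    qed
    then show ?thesis using loop_avoids_injective_values[OF cont, of Y t] g(2) t by simp
  qed
  have "\<exists>Z\<in>I. g t \<in> piece Z" if "t \<in> {0..1}" for t
    using in_piece[of "g t"] gX nint that by metis
  then obtain \<zeta> where \<zeta>: "\<And>t. t \<in> {0..1} \<Longrightarrow> \<zeta> t \<in> I \<and> g t \<in> piece (\<zeta> t)" by metis
  \<comment> \<open>A change of piece would change a separating \<open>mass Y\<close> from 0 to 1 or
    back, so that it takes the forbidden value \<open>1 / 2\<close>.\<close>
  have "\<zeta> t = \<zeta> 0" if t: "t \<in> {0..1}" for t
  proof (rule ccontr)
    assume "\<zeta> t \<noteq> \<zeta> 0"
    then obtain Y where Y: "Y \<in> I" "Y \<noteq> R" "side Y (\<zeta> t) \<noteq> side Y (\<zeta> 0)"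
      using sides_separate[of "\<zeta> t" "\<zeta> 0"] \<zeta>[of t] \<zeta>[of 0] t by auto
    then have m: "mass Y (g t) = side Y (\<zeta> t)" "mass Y (g 0) = side Y (\<zeta> 0)"
      using mass_piece \<zeta>[of t] \<zeta>[of 0] t by auto
    have "continuous_on {0..t} (mass Y \<circ> g)" using continuous_on_subset[OF cont] t by auto
    moreover have "min (side Y (\<zeta> 0)) (side Y (\<zeta> t)) \<le> 1 / 2" "1 / 2 \<le> max (side Y (\<zeta> 0)) (side Y (\<zeta> t))"
      using Y(3) side_cases[of Y "\<zeta> t"] side_cases[of Y "\<zeta> 0"] by (elim disjE; simp)+
    ultimately obtain u where "u \<in> {0..t}" "(mass Y \<circ> g) u = 1 / 2"
      using IVT_between[of 0 t "mass Y \<circ> g" "1 / 2"] t unfolding m[symmetric] by auto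
    then show False using nint[OF Y(2), of u] t by auto
  qed
  then have "g ` {0..1} \<subseteq> piece (\<zeta> 0)" using \<zeta> by (metis image_subsetI)
  moreover have "\<zeta> 0 \<in> I" using \<zeta>[of 0] by simp
  ultimately show ?thesis using that by blast
qed

lemma tree_graded: "tree_graded T.points T.d (piece ` I)"
  unfolding tree_graded_def
proof (intro conjI ballI impI allI)
  show "geodesic_space T.points T.d" by (rule T.unit_length_geodesic) simp
  show "P \<subseteq> T.points" "geodesic_space P T.d" if "P \<in> piece ` I" for P
    using that piece_subset piece_geodesic by auto
  \<comment> \<open>Distinct pieces are even disjoint: a separating \<open>mass Y\<close> is
    constant on each, with different values.\<close>
  show "x = y" if P: "P \<in> piece ` I" "P' \<in> piece ` I" "P \<noteq> P'" and "x \<in> P \<inter> P'" for P P' x y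
  proof -
    obtain Z Z' where Z: "Z \<in> I" "Z' \<in> I" "P = piece Z" "P' = piece Z'" "Z \<noteq> Z'" using P by auto
    obtain Y where "side Y Z \<noteq> side Y Z'" using sides_separate Z by metis
    then show ?thesis using mass_piece[of Z x Y] mass_piece[of Z' x Y] that Z by auto
  qed
  show "\<exists>P\<in>piece ` I. g ` {0..1} \<subseteq> P" if loop: "simple_loop_in T.mtopology g" for g
  proof -
    obtain Z where "Z \<in> I" "g ` {0..1} \<subseteq> piece Z" using simple_loop_in_piece[OF loop] .
    then show ?thesis by blast
  qed
qed

section \<open>Comparison of the path metrics\<close>

abbreviation vp :: "'i \<Rightarrow> 'v \<Rightarrow> 'i \<times> 'v \<Rightarrow> real" where "vp X x \<equiv> vertex_pt (X, x)"

lemma T_triangle: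
  assumes "T.d p q \<le> a" "T.d q r \<le> b" "p \<in> T.points" "q \<in> T.points" "r \<in> T.points" "a + b \<le> c"
  shows "T.d p r \<le> c"
  using T.triangle[OF assms(3-5)] assms(1,2,6) by linarith

lemma dist_in_piece:
  assumes "X \<in> I" "Y \<in> I" "Z \<in> I" "X \<noteq> Y" "Z \<noteq> Y" "D Y X Z \<le> ereal c"
    and "x \<in> pr Y X \<union> pr Y Z" "z \<in> pr Y X \<union> pr Y Z"
  shows "T.d (vp Y x) (vp Y z) \<le> c"
proof -
  have "x \<in> V Y" "z \<in> V Y"
    using pr_subset[OF assms(1,2,4)] pr_subset[OF assms(3,2,5)] assms(7,8) by auto
  then have "vertex_pt x \<in> Y_space Y" "vertex_pt z \<in> Y_space Y" unfolding realization_def by auto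
  from piece_isometry[OF assms(2) this] show ?thesis using D_le_dist[OF assms] by simp
qed

lemma vp_in: "X \<in> I \<Longrightarrow> Y \<in> I \<Longrightarrow> X \<noteq> Y \<Longrightarrow> y \<in> pr Y X \<Longrightarrow> vp Y y \<in> T.points"
  using T.vertex_pt_in pr_subset[of X Y] by auto

text \<open>The route crosses \<open>U\<close> to the foot of the bridge, which lies in
  \<open>pr U R\<close> (cost \<open>c\<close>), takes the bridge (cost 1), and moves inside the
  projection of \<open>X\<close> to \<open>par U\<close> (cost \<theta>).\<close>

lemma dist_to_parent:
  assumes X: "X \<in> I" "Z \<in> I" and U: "U \<in> I" "U \<noteq> R" "Z \<noteq> U" "X \<noteq> par U"
    and u: "u \<in> pr U Z" and D: "D U R Z \<le> ereal c"
    and eq: "pr (par U) U = pr (par U) X" and y: "y \<in> pr (par U) X"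
  shows "T.d (vp U u) (vp (par U) y) \<le> c + 1 + \<theta>"
proof -
  note P = par_in[OF U(1)] par_neq[OF U(1,2)]
  have pt1: "pt U (par U) \<in> pr U R" using pt_in(1)[OF U(1) P(1)] P(2) par_pr[OF U(1)] by auto
  have pt2: "pt (par U) U \<in> pr (par U) X" using pt_in(1)[OF P(1) U(1)] P(2) eq by auto
  have d1: "T.d (vp U u) (vp U (pt U (par U))) \<le> c"
    using U X root u pt1 by (intro dist_in_piece[OF _ _ _ _ _ D]) auto
  have d2: "T.d (vp U (pt U (par U))) (vp (par U) (pt (par U) U)) \<le> 1"
    using T.dist_adjacent[OF bridge_adj[OF U(1,2)]] by simp
  have d3: "T.d (vp (par U) (pt (par U) U)) (vp (par U) y) \<le> real \<theta>"
    using diam_self[of X "par U"] X P U y pt2 by (intro dist_in_piece[of X "par U" X]) auto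
  have pts: "vp U u \<in> T.points" "vp U (pt U (par U)) \<in> T.points" "vp (par U) (pt (par U) U) \<in> T.points" "vp (par U) y \<in> T.points"
    using vp_in[OF X(2) U(1,3) u] vp_in[OF root U(1) _ pt1] vp_in[OF X(1) P(1) U(4)] pt2 y U(2) by auto
  show ?thesis
    by (rule T_triangle[OF T_triangle[OF d1 d2 pts(1-3) order_refl] d3 pts(1,3,4) order_refl])
qed

text \<open>The lowest common ancestor of two pieces neither of which is above the other. As a
  predicate with a unique solution it lets climbs from both sides be matched.\<close>

definition meet :: "'i \<Rightarrow> 'i \<Rightarrow> 'i \<Rightarrow> bool" where
  "meet X Z Y \<longleftrightarrow> Y \<in> insert R (chain X \<inter> chain Z) \<and> chain X \<inter> chain Z \<subseteq> insert Y (chain Y)"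

lemma meet_unique:
  assumes "meet X Z Y" "meet X Z Y'" "X \<in> I" shows "Y = Y'"
proof (rule ccontr)
  assume ne: "Y \<noteq> Y'"
  have R: "R \<notin> chain X" using chainD(2) by blast
  have "Y \<noteq> R \<and> Y' \<noteq> R" using assms(1,2) ne R unfolding meet_def by auto
  then have "Y \<in> chain X" "Y' \<in> chain X" "Y \<in> chain Y'" "Y' \<in> chain Y"
    using assms(1,2) ne unfolding meet_def by auto
  then show False using chain_asym chainD(1) by blast
qed

text \<open>Cost of one step up: \<open>2 * K\<close> across a piece, 1 for the bridge, \<theta> for
  the projection in the parent.\<close>

definition step_bound :: real where "step_bound = 2 * K + 1 + \<theta>"

text \<open>Goes from parent to parent until \<open>U\<close> is an ancestor of \<open>Z\<close>
  too; \<open>n\<close> bounds the number of steps left. The final \<theta> is spent inside the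
  meet.\<close>

lemma climb:
  assumes adj: "PK_adj I V A pr K X Z" and "X \<noteq> R" "Z \<noteq> R" "Z \<notin> chain X"
    and "U \<in> insert R (chain X)" "u \<in> pr U X" "chain X \<inter> chain Z \<subseteq> insert U (chain U)"
    and "card ((chain X - chain Z) \<inter> insert U (chain U)) \<le> n"
  shows "\<exists>Y. meet X Z Y \<and> (\<forall>y\<in>pr Y X. T.d (vp U u) (vp Y y) \<le> n * step_bound + \<theta>)"
  using assms(5-8)
proof (induction n arbitrary: U u)
  note X = adjD(1,2)[OF adj]
  case (0 U u)
  have "U \<in> I" "U \<noteq> X" using 0(1) chainD(1,3)[of U X] root assms(2) by auto
  have "finite (chain X - chain Z)" using finite_chain[OF X(1)] by simp
  then have "U \<notin> chain X - chain Z" using 0(4) by auto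
  then have "meet X Z U" using 0 unfolding meet_def by auto
  moreover have "T.d (vp U u) (vp U y) \<le> real \<theta>" if "y \<in> pr U X" for y
    using diam_self[of X U] that 0(2) X \<open>U \<in> I\<close> \<open>U \<noteq> X\<close> by (intro dist_in_piece[of X U X]) auto
  ultimately show ?case by auto
next
  note X = adjD(1,2)[OF adj]
  case (Suc n U u)
  have U: "U \<in> I" "U \<noteq> X" using Suc.prems(1) chainD(1,3)[of U X] root assms(2) by auto
  show ?case
  proof (cases "U \<in> chain X - chain Z")
    case False
    then have "meet X Z U" using Suc.prems unfolding meet_def by auto
    moreover have "T.d (vp U u) (vp U y) \<le> real \<theta>" if "y \<in> pr U X" for y
      using diam_self[of X U] that Suc.prems(2) X U by (intro dist_in_piece[of X U X]) auto
    moreover have "real \<theta> \<le> real (Suc n) * step_bound + \<theta>" unfolding step_bound_def by simp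
    ultimately show ?thesis by (intro exI[of _ U]) force
  next
    case True
    then have UX: "U \<in> chain X" and UZ: "U \<notin> chain Z" by auto
    note U' = chainD[OF UX]
    define P where "P = par U"
    have chU: "chain U = (if P = R then {} else insert P (chain P))"
      unfolding P_def by (rule chain_eq[OF U(1)])
    have P: "P \<in> I" "P \<noteq> U" using par_in par_neq U U' unfolding P_def by auto
    have PX: "P \<in> insert R (chain X)"
      using par_in_chain[OF U(1)] chain_trans[OF _ UX X(1)] unfolding P_def by blast
    then have "X \<noteq> P" using assms(2) chainD(3) by blast
    have "U \<noteq> Z" using UX assms(4) by blast
    have eq: "pr P U = pr P X"
    proof (cases "P = R")
      case True
      then show ?thesis using chain_pr(1)[OF UX X(1)] by simp
    next
      case False
      then show ?thesis using chain_pr_between(2)[OF _ UX X(1)] par_in_chain[OF U(1)] unfolding P_def by simp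
    qed
    \<comment> \<open>\<open>U\<close> is not in \<open>chain Z\<close>, and \<open>X\<close> and
      \<open>Z\<close> are adjacent: together this bounds the crossing of \<open>U\<close>, although
      \<open>D U R X\<close> itself exceeds \<open>K\<close>.\<close>
    have "D U R Z \<le> ereal (real K)" "D U Z X \<le> ereal (real K)"
      using UZ U U' \<open>U \<noteq> Z\<close> adjD(4)[OF adj U(1)] D_sym[of U] unfolding chain_def by (auto simp: not_less)
    then have D: "D U R X \<le> ereal (2 * real K)"
      using U U' X root \<open>U \<noteq> Z\<close> by (intro D_triangle[of R U X Z]) auto
    obtain v where v: "v \<in> pr P X" using pr_nonempty[OF X(1) P(1) \<open>X \<noteq> P\<close>] by blast
    have st: "T.d (vp U u) (vp P v) \<le> step_bound"
      using dist_to_parent[OF X(1) X(1) U(1) _ _ _ Suc.prems(2) D] U U' eq v \<open>X \<noteq> P\<close>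
      unfolding P_def step_bound_def by (simp add: algebra_simps)
    have sub: "chain X \<inter> chain Z \<subseteq> insert P (chain P)"
      using Suc.prems(3) UZ chU by (auto split: if_splits)
    have "(chain X - chain Z) \<inter> insert P (chain P) \<subset> (chain X - chain Z) \<inter> insert U (chain U)"
    proof (rule psubsetI)
      have "R \<notin> chain X" using chainD(2) by blast
      then show "(chain X - chain Z) \<inter> insert P (chain P) \<subseteq> (chain X - chain Z) \<inter> insert U (chain U)"
        using chU by (auto split: if_splits)
      have "U \<notin> insert P (chain P)" using chU P(2) chainD(3)[of U U] by (cases "P = R") auto
      then show "(chain X - chain Z) \<inter> insert P (chain P) \<noteq> (chain X - chain Z) \<inter> insert U (chain U)"
        using True by blast
    qed
    then have "card ((chain X - chain Z) \<inter> insert P (chain P)) <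
        card ((chain X - chain Z) \<inter> insert U (chain U))"
      using finite_chain[OF X(1)] by (intro psubset_card_mono) auto
    with Suc.prems(4) have "card ((chain X - chain Z) \<inter> insert P (chain P)) \<le> n" by linarith
    from Suc.IH[OF PX v sub this] obtain Y where Y: "meet X Z Y"
      "\<And>y. y \<in> pr Y X \<Longrightarrow> T.d (vp P v) (vp Y y) \<le> n * step_bound + \<theta>" by blast
    have YI: "Y \<in> I" "X \<noteq> Y" 
      using Y(1) chainD(1,3)[of Y X] root assms(2) unfolding meet_def by auto
    have "T.d (vp U u) (vp Y y) \<le> real (Suc n) * step_bound + \<theta>" if y: "y \<in> pr Y X" for y
      using vp_in[OF X(1) U(1) _ Suc.prems(2)] vp_in[OF X(1) P(1) _ v] vp_in[OF X(1) YI(1,2) y]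
        U(2) \<open>X \<noteq> P\<close>
      by (intro T_triangle[OF st Y(2)[OF y]]) (auto simp: algebra_simps)
    then show ?thesis using Y(1) by blast
  qed
qed

text \<open>The 3 is one step out of \<open>X\<close>, which is not in its own chain, plus two for
  the elements allowed by \<open>adj_excess\<close>.\<close>

lemma climb_to_meet:
  assumes adj: "PK_adj I V A pr K X Z" and "X \<noteq> R" "Z \<noteq> R" "Z \<notin> chain X" "X \<notin> chain Z"
    and x: "x \<in> pr X Z"
  shows "\<exists>Y. meet X Z Y \<and> (\<forall>y\<in>pr Y X. T.d (vp X x) (vp Y y) \<le> 3 * step_bound + \<theta>)"
proof -
  note X = adjD(1-3)[OF adj]
  define P where "P = par X"
  have P: "P \<in> I" "X \<noteq> P" using par_in[OF X(1)] par_neq[OF X(1) assms(2)] unfolding P_def by auto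
  have chX: "chain X = (if P = R then {} else insert P (chain P))"
    unfolding P_def by (rule chain_eq[OF X(1)])
  obtain v where v: "v \<in> pr P X" using pr_nonempty[OF X(1) P] by blast
  have "D X R Z \<le> ereal (real K)"
    using assms(2-5) X unfolding chain_def by (auto simp: not_less)
  from dist_to_parent[OF X(1,2,1) assms(2) _ _ x this] have st: "T.d (vp X x) (vp P v) \<le> step_bound"
    using X P v unfolding P_def step_bound_def by force
  have "card ((chain X - chain Z) \<inter> insert P (chain P)) \<le> card {par X, par (par X)}"
    using adj_excess[OF adj assms(2-4)] by (intro card_mono) auto
  also have "\<dots> \<le> 2" by (simp add: card_insert_if)
  finally obtain Y where Y: "meet X Z Y"
      "\<And>y. y \<in> pr Y X \<Longrightarrow> T.d (vp P v) (vp Y y) \<le> real 2 * step_bound + \<theta>"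
    using climb[OF adj assms(2-4), of P v 2] chX v by (auto split: if_splits)
  have YI: "Y \<in> I" "X \<noteq> Y"
    using Y(1) chainD(1,3)[of Y X] root assms(2) unfolding meet_def by auto
  have "T.d (vp X x) (vp Y y) \<le> 3 * step_bound + \<theta>" if y: "y \<in> pr Y X" for y
    using vp_in[OF X(2,1) _ x] vp_in[OF X(1) P(1) P(2) v] vp_in[OF X(1) YI(1,2) y] X(3)
    by (intro T_triangle[OF st Y(2)[OF y]]) auto
  then show ?thesis using Y(1) by blast
qed

text \<open>Two climbs to the meet, and at most \<open>K\<close> across it by adjacency.\<close>

definition edge_bound :: real where "edge_bound = 2 * (3 * step_bound + \<theta>) + K"

lemma edge_bound_ge: "1 \<le> edge_bound" "1 + 2 * \<theta> \<le> edge_bound"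
  unfolding edge_bound_def step_bound_def by auto

lemma dist_ancestor:
  assumes adj: "PK_adj I V A pr K X Z" and "X \<noteq> R" "Z = R \<or> Z \<in> chain X"
    and x: "x \<in> pr X Z" and z: "z \<in> pr Z X"
  shows "T.d (vp X x) (vp Z z) \<le> edge_bound"
proof -
  note X = adjD(1-3)[OF adj]
  have Z: "Z = par X" by (rule adj_ancestor[OF adj assms(2,3)])
  have x': "x \<in> pr X R" using x par_pr[OF X(1)] Z by simp
  have "T.d (vp X x) (vp (par X) z) \<le> real \<theta> + 1 + real \<theta>"
    using X Z z assms(2) diam_self[OF root X(1)] root
    by (intro dist_to_parent[OF X(1) root X(1) assms(2) _ _ x']) auto
  then show ?thesis using Z edge_bound_ge(2) by simp
qed

lemma dist_adjacent:
  assumes adj: "PK_adj I V A pr K X Z" and x: "x \<in> pr X Z" and z: "z \<in> pr Z X"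
  shows "T.d (vp X x) (vp Z z) \<le> edge_bound"
proof -
  note X = adjD(1-3)[OF adj]
  have adj': "PK_adj I V A pr K Z X" using adj D_sym unfolding PK_adj_def by (metis insert_commute)
  consider "X \<noteq> R" "Z = R \<or> Z \<in> chain X" | "Z \<noteq> R" "X = R \<or> X \<in> chain Z"
    | "X \<noteq> R" "Z \<noteq> R" "Z \<notin> chain X" "X \<notin> chain Z" using X(3) by blast
  then show ?thesis
  proof cases
    case 1
    then show ?thesis using dist_ancestor[OF adj _ _ x z] by blast
  next
    case 2
    then show ?thesis using dist_ancestor[OF adj' _ _ z x] T.commute by metis
  next
    case 3
    obtain Y where Y: "meet X Z Y" "\<And>y. y \<in> pr Y X \<Longrightarrow> T.d (vp X x) (vp Y y) \<le> 3 * step_bound + \<theta>"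
      using climb_to_meet[OF adj 3 x] by blast
    obtain Y' where Y': "meet Z X Y'" "\<And>y. y \<in> pr Y' Z \<Longrightarrow> T.d (vp Z z) (vp Y' y) \<le> 3 * step_bound + \<theta>"
      using climb_to_meet[OF adj' 3(2,1,4,3) z] by blast
    have "Y' = Y" using meet_unique[OF _ Y(1) X(1), of Y'] Y'(1) unfolding meet_def by (simp add: Int_commute)
    have YI: "Y \<in> I" "X \<noteq> Y" "Z \<noteq> Y" 
      using Y(1) chainD(1)[of Y X] chainD(3)[of Y X] chainD(3)[of Y Z] root 3 unfolding meet_def by auto
    obtain y y' where y: "y \<in> pr Y X" "y' \<in> pr Y Z"
      using pr_nonempty[OF X(1) YI(1,2)] pr_nonempty[OF X(2) YI(1,3)] by blast
    have D: "D Y X Z \<le> ereal (real K)" using adjD(4)[OF adj YI(1)] YI by (auto simp: not_less)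
    have d1: "T.d (vp Y y) (vp Y y') \<le> real K"
      using y X YI by (intro dist_in_piece[OF _ _ _ _ _ D]) auto
    have d2: "T.d (vp Y y') (vp Z z) \<le> 3 * step_bound + \<theta>"
      using Y'(2) \<open>Y' = Y\<close> y T.commute by metis
    note pts = vp_in[OF X(2,1) X(3)[symmetric] x] vp_in[OF X(1) YI(1,2) y(1)] vp_in[OF X(2) YI(1,3) y(2)]
      vp_in[OF X(1,2,3) z]
    show ?thesis
      using T_triangle[OF T_triangle[OF Y(2)[OF y(1)] d1 pts(1-3) order_refl] d2 pts(1,3,4)]
      unfolding edge_bound_def by simp
  qed
qed

lemma C_edge_dist: assumes "C_adj a b" shows "T.d (vertex_pt a) (vertex_pt b) \<le> edge_bound"
proof -
  obtain X x Y y where ab: "a = (X, x)" "b = (Y, y)" by (cases a; cases b) blast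
  then consider "X \<in> I" "X = Y" "A X x y" | "PK_adj I V A pr K X Y" "x \<in> pr X Y" "y \<in> pr Y X"
    using assms unfolding CK_adj_def by auto
  then show ?thesis
  proof cases
    case 1
    then have "T.d (vertex_pt a) (vertex_pt b) \<le> 1" using ab by (intro T.dist_adjacent) (simp add: T_adj_def)
    then show ?thesis using edge_bound_ge by simp
  next
    case 2
    then show ?thesis using dist_adjacent ab by blast
  qed
qed

text \<open>The \<open>T\<close>-distance from \<open>a\<close>, divided by
  \<open>edge_bound\<close>, changes by at most 1 along each edge of \<open>\<C>\<^sub>K\<close>.
  Its interpolation bounds the infimum from below, without rerouting walks.\<close>

lemma T_le_C:
  assumes "a \<in> Sigma I V" "b \<in> Sigma I V"
  shows "T.d (vertex_pt a) (vertex_pt b) \<le> edge_bound * C.d (vertex_pt a) (vertex_pt b)"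
proof -
  define \<phi> where "\<phi> = (\<lambda>w. T.d (vertex_pt a) (vertex_pt w) / edge_bound)"
  have "\<bar>\<phi> u - \<phi> v\<bar> \<le> CK_length K u v" if uv: "C_adj u v" for u v
  proof -
    have in_X: "vertex_pt a \<in> T.points" "vertex_pt u \<in> T.points" "vertex_pt v \<in> T.points"
      using assms(1) C.adjD(1,2)[OF uv] T.vertex_pt_in by blast+
    have "\<bar>T.d (vertex_pt a) (vertex_pt u) - T.d (vertex_pt a) (vertex_pt v)\<bar> \<le> edge_bound"
      using T.triangle[OF in_X(1,2,3)] T.triangle[OF in_X(1,3,2)] C_edge_dist[OF uv]
        T.commute[of "vertex_pt u" "vertex_pt v"] by linarith
    then have "\<bar>\<phi> u - \<phi> v\<bar> \<le> 1"
      using edge_bound_ge(1) unfolding \<phi>_def diff_divide_distrib[symmetric] by (simp add: divide_le_eq_1)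
    then show ?thesis using C.length_ge_1[OF uv] by simp
  qed
  then have "\<bar>interp \<phi> (vertex_pt a) - interp \<phi> (vertex_pt b)\<bar> \<le> C.d (vertex_pt a) (vertex_pt b)"
    using assms by (intro C.interp_lipschitz C.vertex_pt_in)
  then have "T.d (vertex_pt a) (vertex_pt b) / edge_bound \<le> C.d (vertex_pt a) (vertex_pt b)"
    using T.vertex_pt_in[OF assms(1)] edge_bound_ge(1) unfolding \<phi>_def by simp
  then show ?thesis using edge_bound_ge(1) by (simp add: divide_le_eq mult.commute)
qed

lemma CK_length_le: "CK_length K (a :: 'i \<times> 'v) b \<le> K"
  using K_pos unfolding CK_length_def by (auto split: prod.splits)

lemma C_le_T:
  assumes "a \<in> Sigma I V" "b \<in> Sigma I V"
  shows "C.d (vertex_pt a) (vertex_pt b) \<le> K * T.d (vertex_pt a) (vertex_pt b)"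
proof -
  have "C.d (push (\<lambda>a. a) (vertex_pt a)) (push (\<lambda>a. a) (vertex_pt b)) \<le> K * T.d (vertex_pt a) (vertex_pt b)"
    by (rule push_dist[OF T.metric_graph_axioms C.metric_graph_axioms])
      (use K_pos T_C_adj CK_length_le T.vertex_pt_in assms in \<open>simp_all\<close>)
  then show ?thesis by simp
qed

text \<open>Edges of \<open>\<C>\<^sub>K\<close> need not occur in \<open>T\<close>, so each point
  is sent to a chosen vertex within \<open>K\<close>; on vertices the two metrics have been
  compared.\<close>

lemma quasi_isometric_C_T:
  defines "c \<equiv> 1 + 2 * K * edge_bound"
  shows "quasi_isometric c c C.points C.d T.points T.d"
proof -
  have K1: "1 \<le> real K" using K_pos by simp
  note L1 = edge_bound_ge(1)
  have KL: "real K \<le> K * edge_bound" "edge_bound \<le> K * edge_bound"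
    using mult_left_mono[OF L1, of K] mult_right_mono[OF K1, of edge_bound] L1 by auto
  \<comment> \<open>All the constants that occur below, absorbed into one.\<close>
  have c: "1 \<le> c" "2 * K \<le> c" "edge_bound \<le> c" "edge_bound * (2 * K) \<le> c" "1 + edge_bound * K \<le> c"
    using KL K1 L1 unfolding c_def by (simp_all add: mult.commute mult.left_commute; linarith)+
  have "\<exists>u\<in>Sigma I V. C.d p (vertex_pt u) \<le> K" if "p \<in> C.points" for p
    using C.near_vertex[OF that CK_length_le] by (metis of_nat_0_le_iff)
  then obtain f where f: "\<And>p. p \<in> C.points \<Longrightarrow> f p \<in> Sigma I V \<and> C.d p (vertex_pt (f p)) \<le> K" by metis
  show ?thesis
    unfolding quasi_isometric_def
  proof (intro conjI C.Metric T.Metric exI[of _ "\<lambda>p. vertex_pt (f p)"] ballI)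
    show "(\<lambda>p. vertex_pt (f p)) \<in> C.points \<rightarrow> T.points" using f T.vertex_pt_in by blast
    fix p q assume pq: "p \<in> C.points" "q \<in> C.points"
    define p' q' where "p' = vertex_pt (f p)" and "q' = vertex_pt (f q)"
    have in_X: "p' \<in> C.points" "q' \<in> C.points" using f pq C.vertex_pt_in unfolding p'_def q'_def by blast+
    have near: "C.d p p' \<le> K" "C.d q q' \<le> K" using f pq unfolding p'_def q'_def by auto
    have tri: "C.d p q \<le> C.d p' q' + 2 * K" "C.d p' q' \<le> C.d p q + 2 * K"
      using C.triangle[OF pq(1) in_X(1) pq(2)] C.triangle[OF in_X(1,2) pq(2)]
        C.triangle[OF in_X(1) pq(1) in_X(2)] C.triangle[OF pq in_X(2)]
        near C.commute[of p p'] C.commute[of q q'] by linarith+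
    have CT: "C.d p' q' \<le> K * T.d p' q'" and TC: "T.d p' q' \<le> edge_bound * C.d p' q'"
      using C_le_T T_le_C f pq unfolding p'_def q'_def by blast+
    have "K * T.d p' q' \<le> c * T.d p' q'" using c K1 T.nonneg by (intro mult_right_mono) auto
    moreover have "2 * K \<le> c * c" using mult_mono[OF c(1,2)] c(1) K1 by simp
    ultimately have "C.d p q \<le> c * (T.d p' q' + c)" using tri CT by (simp add: algebra_simps)
    then have "C.d p q / c \<le> T.d p' q' + c" using c(1) by (simp add: divide_le_eq mult.commute)
    then show "C.d p q / c - c \<le> T.d (vertex_pt (f p)) (vertex_pt (f q))" unfolding p'_def q'_def by simp
    have "edge_bound * C.d p' q' \<le> edge_bound * (C.d p q + 2 * K)"
      using tri L1 by (intro mult_left_mono) auto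
    moreover have "edge_bound * C.d p q \<le> c * C.d p q" using c(3) C.nonneg by (intro mult_right_mono)
    ultimately show "T.d (vertex_pt (f p)) (vertex_pt (f q)) \<le> c * C.d p q + c"
      using TC c(4) unfolding p'_def q'_def by (simp add: algebra_simps)
  next
    fix z assume "z \<in> T.points"
    from T.near_vertex[OF this, of 1] obtain w where w: "w \<in> Sigma I V" "T.d z (vertex_pt w) \<le> 1" by auto
    define x where "x = vertex_pt w"
    have x: "x \<in> C.points" unfolding x_def using w C.vertex_pt_in by blast
    \<comment> \<open>The choice \<open>f\<close> need not fix vertices, but it moves them by at
      most \<open>K\<close> in \<open>\<C>\<^sub>K\<close>, hence boundedly in
      \<open>T\<close>.\<close>
    have "T.d x (vertex_pt (f x)) \<le> edge_bound * C.d x (vertex_pt (f x))"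
      using T_le_C[OF w(1), of "f x"] f[OF x] unfolding x_def by blast
    also have "\<dots> \<le> edge_bound * K" using f[OF x] L1 by (intro mult_left_mono) auto
    finally have "T.d z (vertex_pt (f x)) \<le> c"
      using w f[OF x] \<open>z \<in> T.points\<close> T.vertex_pt_in c(5)
      by (intro T_triangle[OF w(2)[folded x_def]]) (auto simp: x_def)
    then show "\<exists>x\<in>C.points. T.d z (vertex_pt (f x)) \<le> c" using x by blast
  qed (use c in auto)
qed

end

theorem theorem6p7:
  fixes I :: "'i set"
    and V :: "'i \<Rightarrow> 'v set"
    and A :: "'i \<Rightarrow> 'v \<Rightarrow> 'v \<Rightarrow> bool"
    and pr :: "'i \<Rightarrow> 'i \<Rightarrow> 'v set"
    and \<theta> K :: nat
  assumes "graphs_with_projections I V A pr \<theta>"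
    and "K > 0"
    and "K \<ge> 4 * \<theta>"
  shows "\<exists>C::real. \<exists>(T :: ('i \<times> 'v \<Rightarrow> real) set) d \<Q>.
    tree_graded T d \<Q> \<and>
    quasi_isometric C C (CK_space I V A pr K) (CK_dist I V A pr K) T d \<and>
    (\<forall>P\<in>\<Q>. \<exists>Y\<in>I. quasi_isometric C C P d
       (realization (V Y) (A Y)) (path_dist (V Y) (A Y) unit_length))"
proof (cases "I = {}")
  \<comment> \<open>There is no root here; the empty space is tree-graded without pieces, as it
    contains no loop.\<close>
  case True
  define d0 :: "('i \<times> 'v \<Rightarrow> real) \<Rightarrow> ('i \<times> 'v \<Rightarrow> real) \<Rightarrow> real" where "d0 = (\<lambda>_ _. 0)"
  have d0: "Metric_space {} d0" by unfold_locales (auto simp: d0_def)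
  have no_edge: "\<not> CK_adj I V A pr K a b" for a b
    using True by (cases a; cases b) (auto simp: CK_adj_def PK_adj_def)
  then have empty: "CK_space I V A pr K = {}"
    using True by (auto simp: CK_space_def realization_def)
  interpret C: metric_graph "Sigma I V" "CK_adj I V A pr K" "CK_length K"
    using no_edge True by unfold_locales (auto simp: connected_graph_def simple_graph_def)
  have "tree_graded {} d0 {}"
    using d0 unfolding tree_graded_def geodesic_space_def simple_loop_in_def pathin_def
    by (auto simp: continuous_map_def Metric_space.topspace_mtopology funcset_to_empty_iff)
  moreover have "quasi_isometric 1 1 (CK_space I V A pr K) (CK_dist I V A pr K) {} d0"
    using d0 C.Metric empty unfolding quasi_isometric_def CK_space_def CK_dist_def by auto
  ultimately show ?thesis by blast
next
  case False
  then obtain R where "R \<in> I" by blast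
  interpret rooted_projections I V A pr \<theta> K R
    using assms \<open>R \<in> I\<close> unfolding rooted_projections_def rooted_projections_axioms_def by blast
  define c where "c = 1 + 2 * K * edge_bound"
  have "1 \<le> c" using edge_bound_ge(1) unfolding c_def by simp
  then have "\<forall>P\<in>piece ` I. \<exists>Y\<in>I. quasi_isometric c c P T.d (Y_space Y) (Y_dist Y)"
    using piece_quasi_isometric by blast
  moreover have "quasi_isometric c c (CK_space I V A pr K) (CK_dist I V A pr K) T.points T.d"
    using quasi_isometric_C_T unfolding CK_space_def CK_dist_def c_def .
  ultimately show ?thesis using tree_graded by (intro exI conjI)
qed

end
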